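(* Let $X$ be a compact metric space, $r:X\to X$ Borel measurable with $0<\#r^{-1}(x)<\infty$ for all $x$, and $\mu$ a strongly invariant Borel probability measure on $X$. Let $m_0=1$ and let $(\mathcal H,U,\pi,\varphi)$ be the associated wavelet representation, realized on the solenoid as in the context. The following are equivalent: (i) the automorphism $r_\infty$ on $(X_\infty,\mu_\infty)$ is ergodic; (ii) the wavelet representation is irreducible (the commutant of $\{U\}\cup\{\pi(f):f\in L^\infty(X)\}$ consists only of scalars); (iii) the only bounded functions $h$ with $R_1h=h$ are the constants, where $R_1h(x)=\frac{1}{\#r^{-1}(x)}\sum_{r(y)=x}h(y)$; (iv) the only functions $h\in L^2(X,\mu)$ with $R_1h=h$ are the constants; (v) the endomorphism $r$ on $(X,\mu)$ is ergodic.
   Context: Strongly invariant: $\int f\,d\mu=\int\frac{1}{\#r^{-1}(x)}\sum_{r(y)=x}f(y)\,d\mu(x)$ for all $f\in C(X)$. Solenoid: $X_\infty=\{(x_0,x_1,\dots)\in X^{\mathbb N}: r(x_{n+1})=x_n\ \forall n\}$, $r_\infty(x_0,x_1,\dots)=(r(x_0),x_0,x_1,\dots)$, $\theta_0(x_0,\dots)=x_0$. With $W(x)=1/\#r^{-1}(r(x))$, the path measure $P_x$ on $\Omega_x=\{(x_n)\in X_\infty:x_0=x\}$ is $P_x(\{x_1=z_1,\dots,x_n=z_n\})=W(z_1)\cdots W(z_n)$ and $\int f\,d\mu_\infty=\int_X\int_{\Omega_x}f\,dP_x\,d\mu(x)$. Then $\mathcal H=L^2(X_\infty,\mu_\infty)$,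 $Uf=f\circ r_\infty$, $\pi(f)g=(f\circ\theta_0)g$, $\varphi=1$. Ergodicity of $r$ on $(X,\mu)$ means every $f\in L^\infty(X,\mu)$ with $f\circ r=f$ $\mu$-a.e. is constant $\mu$-a.e. *)

theory Defs
  imports "HOL-Probability.Probability"
begin

definition R1 :: "('a \<Rightarrow> 'a) \<Rightarrow> ('a \<Rightarrow> 'b::real_vector) \<Rightarrow> 'a \<Rightarrow> 'b" where
  "R1 r h x = (1 / real (card (r -` {x}))) *\<^sub>R (\<Sum>y\<in>r -` {x}. h y)"

definition strongly_invariant :: "('a::topological_space \<Rightarrow> 'a) \<Rightarrow> 'a measure \<Rightarrow> bool" where
  "strongly_invariant r \<mu> \<longleftrightarrow>
     (\<forall>f::'a \<Rightarrow> real. continuous_on UNIV f \<longrightarrow>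
        (\<integral>x. f x \<partial>\<mu>) = (\<integral>x. R1 r f x \<partial>\<mu>))"

definition solenoid :: "('a \<Rightarrow> 'a) \<Rightarrow> (nat \<Rightarrow> 'a) set" where
  "solenoid r = {\<omega>. \<forall>n. r (\<omega> (Suc n)) = \<omega> n}"

definition r_inf :: "('a \<Rightarrow> 'a) \<Rightarrow> (nat \<Rightarrow> 'a) \<Rightarrow> (nat \<Rightarrow> 'a)" where
  "r_inf r \<omega> = (\<lambda>n. if n = 0 then r (\<omega> 0) else \<omega> (n - 1))"

definition theta0 :: "(nat \<Rightarrow> 'a) \<Rightarrow> 'a" where
  "theta0 \<omega> = \<omega> 0"

definition W :: "('a \<Rightarrow> 'a) \<Rightarrow> 'a \<Rightarrow> real" where
  "W r z = 1 / real (card (r -` {r z}))"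

text \<open>Finite paths x = x_0, x_1, ..., x_n with r(x_{k+1}) = x_k (coordinates beyond n
  are normalised to undefined, so that the set is finite).\<close>
definition paths :: "('a \<Rightarrow> 'a) \<Rightarrow> nat \<Rightarrow> 'a \<Rightarrow> (nat \<Rightarrow> 'a) set" where
  "paths r n x = {\<omega>. \<omega> 0 = x \<and> (\<forall>k<n. r (\<omega> (Suc k)) = \<omega> k) \<and> (\<forall>k>n. \<omega> k = undefined)}"

definition path_prob :: "('a \<Rightarrow> 'a) \<Rightarrow> nat \<Rightarrow> (nat \<Rightarrow> 'a) \<Rightarrow> real" where
  "path_prob r n \<omega> = (\<Prod>k\<in>{1..n}. W r (\<omega> k))"

text \<open>The measure mu_inf on the solenoid: its sigma-algebra is the one generated by the
  coordinate maps, and for every cylinder set (depending on the coordinates 0..n)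
  mu_inf(C) = int_X P_x(C) d mu(x), P_x being the path measure above.  Cylinder sets form
  an intersection-stable generator, so this determines mu_inf uniquely.\<close>
definition solenoid_measure ::
  "('a::topological_space \<Rightarrow> 'a) \<Rightarrow> 'a measure \<Rightarrow> (nat \<Rightarrow> 'a) measure \<Rightarrow> bool" where
  "solenoid_measure r \<mu> \<nu> \<longleftrightarrow>
     sets \<nu> = sets (restrict_space (PiM UNIV (\<lambda>_. (borel :: 'a measure))) (solenoid r)) \<and>
     (\<forall>n. \<forall>B \<in> sets (PiM {..n} (\<lambda>_. (borel :: 'a measure))).
        emeasure \<nu> {\<omega> \<in> solenoid r. restrict \<omega> {..n} \<in> B} =
        (\<integral>\<^sup>+ x. ennreal (\<Sum>\<omega>\<in>paths r n x. path_prob r n \<omega> * indicator B (restrict \<omega> {..n})) \<partial>\<mu>))"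

definition ergodic_map :: "'b measure \<Rightarrow> ('b \<Rightarrow> 'b) \<Rightarrow> bool" where
  "ergodic_map M T \<longleftrightarrow>
     (\<forall>f::'b \<Rightarrow> complex. f \<in> borel_measurable M \<longrightarrow> (\<exists>B. AE x in M. cmod (f x) \<le> B) \<longrightarrow>
        (AE x in M. f (T x) = f x) \<longrightarrow> (\<exists>c. AE x in M. f x = c))"

definition L2 :: "'b measure \<Rightarrow> ('b \<Rightarrow> complex) set" where
  "L2 M = {f \<in> borel_measurable M. integrable M (\<lambda>x. (cmod (f x))\<^sup>2)}"

definition L2norm :: "'b measure \<Rightarrow> ('b \<Rightarrow> complex) \<Rightarrow> real" where
  "L2norm M f = sqrt (\<integral>x. (cmod (f x))\<^sup>2 \<partial>M)"

text \<open>A map on representatives which respects a.e. equality, is linear modulo a.e. equality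
  and bounded; these are exactly the bounded linear operators on L^2(M).\<close>
definition bounded_op :: "'b measure \<Rightarrow> (('b \<Rightarrow> complex) \<Rightarrow> ('b \<Rightarrow> complex)) \<Rightarrow> bool" where
  "bounded_op M T \<longleftrightarrow>
     (\<forall>f\<in>L2 M. T f \<in> L2 M) \<and>
     (\<forall>f\<in>L2 M. \<forall>g\<in>L2 M. (AE x in M. f x = g x) \<longrightarrow> (AE x in M. T f x = T g x)) \<and>
     (\<forall>f\<in>L2 M. \<forall>g\<in>L2 M. \<forall>a b. AE x in M. T (\<lambda>y. a * f y + b * g y) x = a * T f x + b * T g x) \<and>
     (\<exists>C. \<forall>f\<in>L2 M. L2norm M (T f) \<le> C * L2norm M f)"

definition wav_U :: "('a \<Rightarrow> 'a) \<Rightarrow> ((nat \<Rightarrow> 'a) \<Rightarrow> complex) \<Rightarrow> ((nat \<Rightarrow> 'a) \<Rightarrow> complex)" where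
  "wav_U r f = (\<lambda>\<omega>. f (r_inf r \<omega>))"

definition wav_pi :: "('a \<Rightarrow> complex) \<Rightarrow> ((nat \<Rightarrow> 'a) \<Rightarrow> complex) \<Rightarrow> ((nat \<Rightarrow> 'a) \<Rightarrow> complex)" where
  "wav_pi g f = (\<lambda>\<omega>. g (theta0 \<omega>) * f \<omega>)"

definition wavelet_irreducible ::
  "('a \<Rightarrow> 'a) \<Rightarrow> 'a measure \<Rightarrow> (nat \<Rightarrow> 'a) measure \<Rightarrow> bool" where
  "wavelet_irreducible r \<mu> \<nu> \<longleftrightarrow>
     (\<forall>T. bounded_op \<nu> T \<longrightarrow>
        (\<forall>f\<in>L2 \<nu>. AE \<omega> in \<nu>. T (wav_U r f) \<omega> = wav_U r (T f) \<omega>) \<longrightarrow>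
        (\<forall>g::'a \<Rightarrow> complex. g \<in> borel_measurable \<mu> \<longrightarrow> (\<exists>B. AE x in \<mu>. cmod (g x) \<le> B) \<longrightarrow>
           (\<forall>f\<in>L2 \<nu>. AE \<omega> in \<nu>. T (wav_pi g f) \<omega> = wav_pi g (T f) \<omega>)) \<longrightarrow>
        (\<exists>c. \<forall>f\<in>L2 \<nu>. AE \<omega> in \<nu>. T f \<omega> = c * f \<omega>))"

end

theory Submission
  imports Defs
begin

text \<open>
  Comparing fibrewise variances, \<open>R1 r h = h\<close> forces \<open>h = h \<circ> r\<close> for \<open>h\<close> in \<open>L2 \<mu>\<close>, so harmonic functions
  and \<open>r\<close>-invariant functions are the same; composing with a bounded injection of the plane
  reduces arbitrary invariant functions to bounded ones.

  On the solenoid \<open>\<omega> k\<close> is a function of \<open>\<omega> n\<close> for \<open>k \<le> n\<close>, so the sets \<open>{\<omega>. \<omega> n \<in> A}\<close> are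
  intersection-stable, and each has measure \<open>\<mu> A\<close>.  Hence the measure is shift invariant, and a
  shift-invariant density on the solenoid is determined by its projection to the 0-th coordinate,
  which is \<open>r\<close>-invariant.

  An operator in the commutant of \<open>U\<close> and \<open>\<pi>\<close> commutes with multiplication by functions of any
  coordinate and maps 1 to a shift-invariant function.  In the ergodic case that function is a
  constant \<open>c\<close>, and the operator is multiplication by \<open>c\<close> on indicators of the above sets, hence
  everywhere.
\<close>

section \<open>The transfer operator\<close>

locale strongly_invariant_map = prob_space \<mu>
  for \<mu> :: "'a::metric_space measure" +
  fixes r :: "'a \<Rightarrow> 'a"
  assumes r_borel: "r \<in> borel_measurable borel"
    and fibre_nonempty: "r -` {x} \<noteq> {}"
    and finite_fibre: "finite (r -` {x})"
    and sets_mu [measurable_cong, simp]: "sets \<mu> = sets borel"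
    and invariant: "strongly_invariant r \<mu>"
begin

lemma space_mu [simp]: "space \<mu> = UNIV"
  using sets_eq_imp_space_eq[OF sets_mu] by simp

lemma prob_UNIV [simp]: "prob UNIV = 1"
  using prob_space by simp

lemma borel_measurable_mu_iff: "f \<in> borel_measurable \<mu> \<longleftrightarrow> f \<in> borel_measurable borel"
  by (simp add: measurable_cong_sets[OF sets_mu])

lemma measurable_r [measurable]: "r \<in> measurable \<mu> \<mu>"
  using r_borel by (simp add: measurable_cong_sets[OF sets_mu sets_mu])

lemma card_fibre_pos: "0 < card (r -` {x})"
  using fibre_nonempty finite_fibre by (simp add: card_gt_0_iff)

section \<open>Algebra of the fibre average\<close>

lemma R1_const [simp]: "R1 r (\<lambda>_. c) x = c"
  using card_fibre_pos[of x] by (simp add: R1_def sum_constant_scaleR)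

lemma R1_add: "R1 r (\<lambda>y. f y + g y) x = R1 r f x + R1 r g x"
  by (simp add: R1_def sum.distrib scaleR_add_right)

lemma R1_diff: "R1 r (\<lambda>y. f y - g y) x = R1 r f x - R1 r g x"
  by (simp add: R1_def sum_subtractf scaleR_diff_right)

lemma R1_mult_right:
  fixes f :: "'a \<Rightarrow> 'b::real_algebra"
  shows "R1 r (\<lambda>y. f y * c) x = R1 r f x * c"
  by (simp add: R1_def sum_distrib_right)

lemma R1_mult_left:
  fixes f :: "'a \<Rightarrow> 'b::real_algebra"
  shows "R1 r (\<lambda>y. c * f y) x = c * R1 r f x"
  by (simp add: R1_def sum_distrib_left)

lemma R1_complex_of_real: "R1 r (\<lambda>y. complex_of_real (h y)) x = complex_of_real (R1 r h x)"
  by (simp add: R1_def scaleR_conv_of_real)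

lemma R1_cong: "(\<And>y. r y = x \<Longrightarrow> f y = g y) \<Longrightarrow> R1 r f x = R1 r g x"
  by (simp add: R1_def)

text \<open>A function of \<open>r y\<close> is constant on each fibre. So \<open>R1 r\<close> is a
  left inverse of composition with \<open>r\<close>, as for a conditional expectation.\<close>

lemma R1_comp [simp]: "R1 r (\<lambda>y. f (r y)) x = f x"
  using R1_cong[of x "\<lambda>y. f (r y)" "\<lambda>_. f x"] by simp

lemma R1_mono:
  fixes f g :: "'a \<Rightarrow> real"
  shows "(\<And>y. f y \<le> g y) \<Longrightarrow> R1 r f x \<le> R1 r g x"
  by (simp add: R1_def sum_mono divide_right_mono)

lemma R1_nonneg:
  fixes f :: "'a \<Rightarrow> real"
  shows "(\<And>y. 0 \<le> f y) \<Longrightarrow> 0 \<le> R1 r f x"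
  using R1_mono[of "\<lambda>_. 0" f x] by simp

lemma tendsto_R1:
  fixes f :: "nat \<Rightarrow> 'a \<Rightarrow> 'b::real_normed_vector"
  shows "(\<And>y. (\<lambda>n. f n y) \<longlonglongrightarrow> g y) \<Longrightarrow> (\<lambda>n. R1 r (f n) x) \<longlonglongrightarrow> R1 r g x"
  unfolding R1_def by (intro tendsto_intros)

text \<open>The Bochner integral of a non-measurable function is 0, so the defining equation applied to
  \<open>1 + f\<close>, whose integral is positive, forces \<open>R1 r f\<close> to be measurable.  This replaces
  the Lusin--Novikov theorem.\<close>

lemma R1_continuous:
  fixes f :: "'a \<Rightarrow> real"
  assumes cont: "continuous_on UNIV f" and f01: "\<And>x. 0 \<le> f x" "\<And>x. f x \<le> 1"
  shows "R1 r f \<in> borel_measurable \<mu>" and "(\<integral>x. R1 r f x \<partial>\<mu>) = (\<integral>x. f x \<partial>\<mu>)"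
proof -
  have f_meas: "f \<in> borel_measurable \<mu>"
    using borel_measurable_continuous_onI[OF cont] by (simp add: borel_measurable_mu_iff)
  have f_int: "integrable \<mu> f"
    by (rule integrable_const_bound[of _ 1]) (use f01 f_meas in auto)
  have "(\<integral>x. 1 + f x \<partial>\<mu>) = (\<integral>x. R1 r (\<lambda>x. 1 + f x) x \<partial>\<mu>)"
    using invariant cont unfolding strongly_invariant_def by (auto intro!: continuous_intros)
  moreover have "(\<integral>x. 1 + f x \<partial>\<mu>) = 1 + (\<integral>x. f x \<partial>\<mu>)"
    using f_int by (simp add: prob_space)
  moreover have "0 \<le> (\<integral>x. f x \<partial>\<mu>)"
    using f01 by simp
  ultimately have "(\<integral>x. R1 r (\<lambda>x. 1 + f x) x \<partial>\<mu>) \<noteq> 0" by linarith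
  then have "integrable \<mu> (R1 r (\<lambda>x. 1 + f x))"
    using not_integrable_integral_eq by blast
  then have "integrable \<mu> (\<lambda>x. R1 r (\<lambda>x. 1 + f x) x - 1)"
    by simp
  then show "R1 r f \<in> borel_measurable \<mu>"
    by (simp add: R1_add)
  show "(\<integral>x. R1 r f x \<partial>\<mu>) = (\<integral>x. f x \<partial>\<mu>)"
    using invariant cont by (auto simp: strongly_invariant_def)
qed

section \<open>Strong invariance extended from continuous to Borel functions\<close>

lemma R1_closed:
  assumes "closed A"
  shows "R1 r (indicat_real A) \<in> borel_measurable \<mu>"
    and "(\<integral>x. R1 r (indicat_real A) x \<partial>\<mu>) = measure \<mu> A"
proof -
  \<comment> \<open>Continuous functions decreasing to the indicator of \<open>A\<close>. The empty
    set is treated apart because \<open>infdist\<close> to it is 0 by convention, which would turn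
    the formula into the constant 1.\<close>
  define f where "f n x = (if A = {} then 0 else max 0 (1 - real n * infdist x A))" for n x
  have cont: "continuous_on UNIV (f n)" for n
    unfolding f_def by (cases "A = {}") (auto intro!: continuous_intros)
  have f0: "0 \<le> f n x" and f1: "f n x \<le> 1" for n x
    by (auto simp: f_def infdist_nonneg)
  have lim: "(\<lambda>n. f n x) \<longlonglongrightarrow> indicat_real A x" for x
  proof (cases "x \<in> A")
    case True
    then have "(\<lambda>n. f n x) = (\<lambda>_. 1)" by (auto simp: f_def fun_eq_iff)
    then show ?thesis using True by simp
  next
    case False
    have "\<forall>\<^sub>F n in sequentially. f n x = 0"
    proof (cases "A = {}")
      case nonempty: False
      then have "infdist x A > 0"
        using False assms in_closed_iff_infdist_zero infdist_nonneg by (metis less_eq_real_def)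
      then have "\<forall>\<^sub>F n in sequentially. 1 / infdist x A \<le> real n"
        by real_asymp
      then show ?thesis
        by eventually_elim (use \<open>infdist x A > 0\<close> nonempty in \<open>auto simp: f_def field_simps\<close>)
    qed (simp add: f_def)
    then show ?thesis using False by (simp add: tendsto_eventually)
  qed
  note R1_lim = tendsto_R1[OF lim]
  note fR = R1_continuous[OF cont f0 f1]
  show meas: "R1 r (indicat_real A) \<in> borel_measurable \<mu>"
    by (rule borel_measurable_LIMSEQ_real[OF R1_lim fR(1)])
  have A: "A \<in> sets \<mu>" using assms by simp
  have bd: "norm (R1 r (f n) x) \<le> 1" for n x
    using R1_nonneg[of "f n", OF f0] R1_mono[of "f n" "\<lambda>_. 1", OF f1] by simp
  have "(\<lambda>n. \<integral>x. R1 r (f n) x \<partial>\<mu>) \<longlonglongrightarrow> (\<integral>x. R1 r (indicat_real A) x \<partial>\<mu>)"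
    by (rule integral_dominated_convergence[where w="\<lambda>_. 1"]) (use meas fR bd R1_lim in auto)
  moreover have "(\<lambda>n. \<integral>x. f n x \<partial>\<mu>) \<longlonglongrightarrow> (\<integral>x. indicat_real A x \<partial>\<mu>)"
  proof (rule integral_dominated_convergence[where w="\<lambda>_. 1"])
    show "f n \<in> borel_measurable \<mu>" for n
      using borel_measurable_continuous_onI[OF cont] by (simp add: borel_measurable_mu_iff)
  qed (use A f0 f1 lim in auto)
  ultimately show "(\<integral>x. R1 r (indicat_real A) x \<partial>\<mu>) = measure \<mu> A"
    using A by (simp add: fR(2) LIMSEQ_unique)
qed

text \<open>Closed sets are an intersection-stable generator of the Borel sets, and a finite average
  respects complements and countable disjoint unions. Measurability and the integral identity are
  carried together, since each induction step needs integrability of the averages already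
  obtained.\<close>

lemma R1_indicator:
  assumes "A \<in> sets borel"
  shows "R1 r (indicat_real A) \<in> borel_measurable \<mu> \<and>
    (\<integral>x. R1 r (indicat_real A) x \<partial>\<mu>) = measure \<mu> A"
proof -
  have bd: "norm (R1 r (indicat_real A) x) \<le> 1" for A x
    using R1_nonneg[of "indicat_real A"] R1_mono[of "indicat_real A" "\<lambda>_. 1" x] by simp
  have "Int_stable (Collect closed :: 'a set set)"
    by (auto simp: Int_stable_def)
  moreover have "Collect closed \<subseteq> Pow (UNIV :: 'a set)" by simp
  moreover have "A \<in> sigma_sets UNIV (Collect closed)"
    using assms by (simp add: borel_eq_closed)
  ultimately show ?thesis
  proof (induct rule: sigma_sets_induct_disjoint)
    case (basic A)
    then show ?case by (simp add: R1_closed)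
  next
    case empty
    then show ?case by simp
  next
    case (compl A)
    have *: "R1 r (indicat_real (UNIV - A)) = (\<lambda>x. 1 - R1 r (indicat_real A) x)"
    proof -
      have "indicat_real (UNIV - A) = (\<lambda>x. 1 - indicat_real A x)"
        by (auto simp: fun_eq_iff indicator_def)
      then show ?thesis by (simp add: R1_diff[abs_def])
    qed
    have "A \<in> sets \<mu>" using compl by (simp add: borel_eq_closed)
    moreover have "integrable \<mu> (R1 r (indicat_real A))"
      by (rule integrable_const_bound[of _ 1]) (use bd compl in auto)
    ultimately show ?case
      using compl prob_compl[of A] by (simp add: * prob_space)
  next
    case (union A)
    have A: "range A \<subseteq> sets \<mu>" using union by (auto simp: borel_eq_closed)

    have R1_sum: "R1 r (\<lambda>x. \<Sum>i<n. indicat_real (A i) x) x = (\<Sum>i<n. R1 r (indicat_real (A i)) x)" for n x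
      by (induct n) (simp_all add: R1_add)
    have ind: "indicat_real (\<Union>i<n. A i) x = (\<Sum>i<n. indicat_real (A i) x)" for n x
      by (rule indicator_UN_disjoint) (use union in \<open>auto simp: disjoint_family_on_def\<close>)
    have lim: "(\<lambda>n. \<Sum>i<n. indicat_real (A i) x) \<longlonglongrightarrow> indicat_real (\<Union>i. A i) x" for x
      unfolding ind[symmetric] by (rule LIMSEQ_indicator_UN)
    have R1_lim: "(\<lambda>n. \<Sum>i<n. R1 r (indicat_real (A i)) x) \<longlonglongrightarrow> R1 r (indicat_real (\<Union>i. A i)) x" for x
      using tendsto_R1[of "\<lambda>n x. \<Sum>i<n. indicat_real (A i) x" "indicat_real (\<Union>i. A i)", OF lim]
      by (simp add: R1_sum)
    have meas: "R1 r (indicat_real (\<Union>i. A i)) \<in> borel_measurable \<mu>"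
      by (rule borel_measurable_LIMSEQ_real[OF R1_lim]) (use union in \<open>auto intro!: borel_measurable_sum\<close>)
    \<comment> \<open>The partial sum is the average of the indicator of a finite disjoint union, so
      the constant 1 dominates.\<close>
    have bd': "norm (\<Sum>i<n. R1 r (indicat_real (A i)) x) \<le> 1" for n x
      using bd[of "\<Union>i<n. A i" x] by (simp add: ind[abs_def] R1_sum)
    have int: "integrable \<mu> (R1 r (indicat_real (A i)))" for i
      by (rule integrable_const_bound[of _ 1]) (use bd union in auto)
    have "(\<lambda>n. \<integral>x. (\<Sum>i<n. R1 r (indicat_real (A i)) x) \<partial>\<mu>) \<longlonglongrightarrow> (\<integral>x. R1 r (indicat_real (\<Union>i. A i)) x \<partial>\<mu>)"
      by (rule integral_dominated_convergence[where w="\<lambda>_. 1"]) (use meas union bd' R1_lim in \<open>auto intro!: borel_measurable_sum\<close>)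
    moreover have "(\<lambda>n. \<Sum>i<n. measure \<mu> (A i)) \<longlonglongrightarrow> measure \<mu> (\<Union>i. A i)"
      using finite_measure_UNION[OF A union(1)] by (simp add: sums_def)
    ultimately show ?case
      using meas union int LIMSEQ_unique by fastforce
  qed
qed

text \<open>Averaging is linear and monotone, so the identity for indicators passes to simple
  functions and then to increasing limits. Extended integrals let it be used before integrability is
  known.\<close>

lemma R1_nonneg_measurable:
  fixes u :: "'a \<Rightarrow> real"
  assumes "u \<in> borel_measurable \<mu>" "\<And>x. 0 \<le> u x"
  shows "R1 r u \<in> borel_measurable \<mu> \<and> (\<integral>\<^sup>+x. ennreal (R1 r u x) \<partial>\<mu>) = (\<integral>\<^sup>+x. ennreal (u x) \<partial>\<mu>)"
  using assms
proof (induct rule: borel_measurable_induct_real)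
  case (set A)
  then have *: "R1 r (indicat_real A) \<in> borel_measurable \<mu>"
    "(\<integral>x. R1 r (indicat_real A) x \<partial>\<mu>) = measure \<mu> A"
    using R1_indicator by auto
  have "integrable \<mu> (R1 r (indicat_real A))"
    by (rule integrable_const_bound[of _ 1])
      (use * R1_nonneg[of "indicat_real A"] R1_mono[of "indicat_real A" "\<lambda>_. 1"] in auto)
  then have "(\<integral>\<^sup>+x. ennreal (R1 r (indicat_real A) x) \<partial>\<mu>) = ennreal (measure \<mu> A)"
    using * R1_nonneg[of "indicat_real A"] by (subst nn_integral_eq_integral) auto
  then show ?case using * set by (simp add: emeasure_eq_measure ennreal_indicator)
next
  case (mult u c)
  then show ?case
    using R1_nonneg[of u]
    by (simp add: R1_mult_left[abs_def] ennreal_mult nn_integral_cmult borel_measurable_times)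
next
  case (add u v)
  then show ?case
    using R1_nonneg[of u] R1_nonneg[of v]
    by (simp add: R1_add[abs_def] ennreal_plus nn_integral_add borel_measurable_add)
next
  case (seq U)
  note R1_lim = tendsto_R1[of U u]
  have lim: "(\<lambda>i. U i x) \<longlonglongrightarrow> u x" for x using seq by simp
  have mono: "incseq (\<lambda>i x. ennreal (R1 r (U i) x))" 
    using \<open>incseq U\<close> by (auto simp: incseq_def le_fun_def intro!: ennreal_leI R1_mono)
  have mono': "incseq (\<lambda>i x. ennreal (U i x))" 
    using \<open>incseq U\<close> by (auto simp: incseq_def le_fun_def intro!: ennreal_leI)
  have "(\<lambda>i. \<integral>\<^sup>+x. ennreal (R1 r (U i) x) \<partial>\<mu>) \<longlonglongrightarrow> (\<integral>\<^sup>+x. ennreal (R1 r u x) \<partial>\<mu>)"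
    by (rule nn_integral_LIMSEQ[OF mono])
      (use seq R1_lim lim in \<open>auto intro: measurable_compose[OF _ measurable_ennreal]\<close>)
  moreover have "(\<lambda>i. \<integral>\<^sup>+x. ennreal (U i x) \<partial>\<mu>) \<longlonglongrightarrow> (\<integral>\<^sup>+x. ennreal (u x) \<partial>\<mu>)"
    by (rule nn_integral_LIMSEQ[OF mono']) (use seq lim in auto)
  moreover have "R1 r u \<in> borel_measurable \<mu>"
    by (rule borel_measurable_LIMSEQ_real[OF R1_lim[OF lim]]) (use seq in auto)
  ultimately show ?case using seq LIMSEQ_unique by fastforce
qed

lemmas measurable_R1_nonneg = R1_nonneg_measurable[THEN conjunct1]
lemmas nn_integral_R1 = R1_nonneg_measurable[THEN conjunct2]

text \<open>For a null set \<open>N\<close>, the average of its indicator has integral 0 and so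
  vanishes almost everywhere. All points of a finite fibre carry positive weight, hence almost every
  fibre misses \<open>N\<close> entirely.\<close>

lemma AE_fibres:
  assumes "AE y in \<mu>. P y"
  shows "AE x in \<mu>. \<forall>y. r y = x \<longrightarrow> P y"
proof -
  obtain N where N: "{y. \<not> P y} \<subseteq> N" "N \<in> sets \<mu>" "emeasure \<mu> N = 0"
    using AE_E[OF assms] by auto
  note mN = measurable_R1_nonneg[of "indicat_real N"]
  have "(\<integral>\<^sup>+x. ennreal (R1 r (indicat_real N) x) \<partial>\<mu>) = 0"
    using N by (subst nn_integral_R1) (auto simp: ennreal_indicator)
  then have "AE x in \<mu>. R1 r (indicat_real N) x = 0"
    using mN N R1_nonneg[of "indicat_real N"]
    by (subst (asm) nn_integral_0_iff_AE) (auto simp: ennreal_eq_0_iff intro: antisym)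
  then show ?thesis
  proof eventually_elim
    case (elim x)
    then have "(\<Sum>y\<in>r -` {x}. indicat_real N y) = 0"
      using card_fibre_pos[of x] by (simp add: R1_def)
    then have "\<forall>y\<in>r -` {x}. indicat_real N y = 0"
      by (subst (asm) sum_nonneg_eq_0_iff) (auto simp: finite_fibre)
    then show ?case using N(1) by (auto simp: indicator_def split: if_splits)
  qed
qed

lemma R1_cong_AE:
  assumes "AE y in \<mu>. f y = g y"
  shows "AE x in \<mu>. R1 r f x = R1 r g x"
  using AE_fibres[OF assms] by eventually_elim (auto intro: R1_cong)

section \<open>Harmonic functions and invariant functions\<close>

lemma R1_fixed_if_comp_fixed:
  assumes "AE y in \<mu>. h (r y) = h y"
  shows "AE x in \<mu>. R1 r h x = h x"
  using R1_cong_AE[OF assms] by (simp add: eq_commute)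

text \<open>The left-hand side is the variance of \<open>h\<close> over the fibre of \<open>x\<close>.\<close>

lemma R1_variance:
  fixes h :: "'a \<Rightarrow> complex"
  shows "R1 r (\<lambda>y. (cmod (h y - R1 r h (r y)))\<^sup>2) x = R1 r (\<lambda>y. (cmod (h y))\<^sup>2) x - (cmod (R1 r h x))\<^sup>2"
proof -
  define m where "m = R1 r h x"
  have Re_m: "R1 r (\<lambda>y. Re (h y)) x = Re m" and Im_m: "R1 r (\<lambda>y. Im (h y)) x = Im m"
    by (simp_all add: m_def R1_def)
  have "R1 r (\<lambda>y. (cmod (h y - R1 r h (r y)))\<^sup>2) x =
    R1 r (\<lambda>y. (cmod (h y))\<^sup>2 + (cmod m)\<^sup>2 - (2 * Re m * Re (h y) + 2 * Im m * Im (h y))) x"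
    unfolding m_def by (rule R1_cong) (auto simp: cmod_power2, simp add: power2_eq_square algebra_simps)
  also have "\<dots> = R1 r (\<lambda>y. (cmod (h y))\<^sup>2) x - (cmod m)\<^sup>2"
    by (simp add: R1_add R1_diff R1_mult_left Re_m Im_m cmod_power2) (simp add: power2_eq_square)
  finally show ?thesis by (simp add: m_def)
qed

text \<open>For harmonic \<open>h\<close> the variance over the fibre of \<open>x\<close> is the
  average of \<open>v\<close>, the squared modulus of \<open>h - h \<circ> r\<close>. By strong
  invariance the integrals of both squared-modulus terms agree, so the total variance is 0.\<close>

lemma comp_fixed_if_R1_fixed:
  assumes h: "h \<in> L2 \<mu>" and fixed: "AE x in \<mu>. R1 r h x = h x"
  shows "AE y in \<mu>. h (r y) = h y"
proof -
  have [measurable]: "h \<in> borel_measurable \<mu>" and int: "integrable \<mu> (\<lambda>x. (cmod (h x))\<^sup>2)"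
    using h by (auto simp: L2_def)
  define v where "v y = (cmod (h y - h (r y)))\<^sup>2" for y
  have [measurable]: "v \<in> borel_measurable \<mu>" unfolding v_def by measurable
  have v_nonneg: "0 \<le> v y" for y by (simp add: v_def)
  \<comment> \<open>For \<open>y\<close> in the fibre of \<open>x\<close> only the value of
    \<open>R1 r h\<close> at the base point \<open>x = r y\<close> enters, so the equation
    \<open>fixed\<close> at \<open>x\<close> suffices.\<close>
  have v_eq: "AE x in \<mu>. R1 r v x + (cmod (h x))\<^sup>2 = R1 r (\<lambda>y. (cmod (h y))\<^sup>2) x"
    using fixed
  proof eventually_elim
    case (elim x)
    have "R1 r v x = R1 r (\<lambda>y. (cmod (h y - R1 r h (r y)))\<^sup>2) x"
      unfolding v_def using elim by (intro R1_cong) auto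
    then show ?case by (simp add: R1_variance elim)
  qed
  have fin: "(\<integral>\<^sup>+x. ennreal ((cmod (h x))\<^sup>2) \<partial>\<mu>) \<noteq> \<infinity>"
    using int by (simp add: integrable_iff_bounded)
  have "(\<integral>\<^sup>+x. ennreal (v x) \<partial>\<mu>) + (\<integral>\<^sup>+x. ennreal ((cmod (h x))\<^sup>2) \<partial>\<mu>) =
    (\<integral>\<^sup>+x. ennreal (R1 r v x) + ennreal ((cmod (h x))\<^sup>2) \<partial>\<mu>)"
    using measurable_R1_nonneg[of v]
    by (subst nn_integral_add) (auto simp: nn_integral_R1 v_nonneg)
  also have "\<dots> = (\<integral>\<^sup>+x. ennreal (R1 r (\<lambda>y. (cmod (h y))\<^sup>2) x) \<partial>\<mu>)"
    using v_eq by (intro nn_integral_cong_AE) (auto simp: R1_nonneg v_def simp flip: ennreal_plus)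
  also have "\<dots> = (\<integral>\<^sup>+x. ennreal ((cmod (h x))\<^sup>2) \<partial>\<mu>)"
    by (rule nn_integral_R1) auto
  \<comment> \<open>Cancellation in the extended reals is legitimate because \<open>h\<close> is
    square-integrable (\<open>fin\<close>).\<close>
  finally have "(\<integral>\<^sup>+x. ennreal (v x) \<partial>\<mu>) = 0"
    using fin ennreal_add_left_cancel[of "\<integral>\<^sup>+x. ennreal ((cmod (h x))\<^sup>2) \<partial>\<mu>" _ 0]
    by (simp add: add.commute)
  then have "AE x in \<mu>. v x = 0"
    by (subst (asm) nn_integral_0_iff_AE) (auto simp: v_def ennreal_eq_0_iff)
  then show ?thesis by eventually_elim (simp add: v_def)
qed

end

section \<open>The solenoid measure\<close>

lemma paths_0: "paths r 0 x = {\<lambda>k. if k = 0 then x else undefined}"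
  by (auto simp: paths_def fun_eq_iff)

text \<open>A path is prolonged at its far end by a point of the fibre over its last coordinate.
  Conversely, truncation must reset coordinate \<open>Suc n\<close> to \<open>undefined\<close>, as
  the normalisation of \<open>paths\<close> demands.\<close>

lemma paths_Suc:
  "paths r (Suc n) x = (\<lambda>(\<omega>, y). fun_upd \<omega> (Suc n) y) ` (SIGMA \<omega>:paths r n x. r -` {\<omega> n})"
proof (intro equalityI subsetI)
  fix \<omega> assume \<omega>: "\<omega> \<in> paths r (Suc n) x"
  let ?\<omega> = "fun_upd \<omega> (Suc n) undefined"
  have "?\<omega> \<in> paths r n x"
    using \<omega> by (auto simp: paths_def less_Suc_eq)
  moreover have "\<omega> (Suc n) \<in> r -` {?\<omega> n}"
    using \<omega> by (auto simp: paths_def)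
  ultimately show "\<omega> \<in> (\<lambda>(\<omega>, y). fun_upd \<omega> (Suc n) y) ` (SIGMA \<omega>:paths r n x. r -` {\<omega> n})"
    by (intro image_eqI[of _ _ "(?\<omega>, \<omega> (Suc n))"]) auto
qed (auto simp: paths_def less_Suc_eq)

text \<open>Coordinate \<open>Suc n\<close> of a path of length \<open>n\<close> is always
  \<open>undefined\<close>, so overwriting it destroys no information.\<close>

lemma inj_on_extend_path:
  "inj_on (\<lambda>(\<omega>, y). fun_upd \<omega> (Suc n) y) (SIGMA \<omega>:paths r n x. r -` {\<omega> n})"
proof (rule inj_onI, clarify)
  fix \<omega> y \<omega>' y'
  assume *: "\<omega> \<in> paths r n x" "\<omega>' \<in> paths r n x" "fun_upd \<omega> (Suc n) y = fun_upd \<omega>' (Suc n) y'"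
  have "\<omega> k = \<omega>' k" for k
    using * by (cases "k = Suc n") (auto simp: paths_def fun_eq_iff split: if_splits)
  moreover have "y = y'"
    using * by (metis fun_upd_same)
  ultimately show "\<omega> = \<omega>' \<and> y = y'" by auto
qed

lemma path_prob_extend:
  assumes "r y = \<omega> n"
  shows "path_prob r (Suc n) (fun_upd \<omega> (Suc n) y) = path_prob r n \<omega> * (1 / real (card (r -` {\<omega> n})))"
  unfolding path_prob_def by (simp add: W_def assms atLeastAtMostSuc_conv mult.commute)

context strongly_invariant_map
begin

lemma finite_paths: "finite (paths r n x)"
  by (induct n) (simp_all add: paths_0 paths_Suc finite_SigmaI finite_fibre)

text \<open>Summing over the last point first averages \<open>u\<close> over the fibre of the point
  before it: one step of the path costs one application of \<open>R1 r\<close>.\<close>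

lemma path_sum_Suc:
  fixes u :: "'a \<Rightarrow> real"
  shows "(\<Sum>\<omega>\<in>paths r (Suc n) x. path_prob r (Suc n) \<omega> * u (\<omega> (Suc n))) =
    (\<Sum>\<omega>\<in>paths r n x. path_prob r n \<omega> * R1 r u (\<omega> n))"
proof -
  have "(\<Sum>\<omega>\<in>paths r (Suc n) x. path_prob r (Suc n) \<omega> * u (\<omega> (Suc n))) =
    (\<Sum>(\<omega>, y)\<in>(SIGMA \<omega>:paths r n x. r -` {\<omega> n}).
      path_prob r n \<omega> * (1 / real (card (r -` {\<omega> n}))) * u y)"
    unfolding paths_Suc
    by (subst sum.reindex[OF inj_on_extend_path]) (auto simp: path_prob_extend intro!: sum.cong)
  also have "\<dots> = (\<Sum>\<omega>\<in>paths r n x. \<Sum>y\<in>r -` {\<omega> n}.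
      path_prob r n \<omega> * (1 / real (card (r -` {\<omega> n}))) * u y)"
    by (rule sum.Sigma[symmetric]) (auto simp: finite_paths finite_fibre)
  finally show ?thesis by (simp add: R1_def sum_divide_distrib sum_distrib_left)
qed

text \<open>The inner sum is the \<open>n\<close>-th iterate of \<open>R1 r\<close> applied to
  \<open>u\<close>, and strong invariance removes the iterates one by one. The induction must vary
  \<open>u\<close>, which is replaced by \<open>R1 r u\<close>.\<close>

lemma nn_integral_path_sum:
  fixes u :: "'a \<Rightarrow> real"
  assumes "u \<in> borel_measurable \<mu>" "\<And>x. 0 \<le> u x"
  shows "(\<integral>\<^sup>+x. ennreal (\<Sum>\<omega>\<in>paths r n x. path_prob r n \<omega> * u (\<omega> n)) \<partial>\<mu>) = (\<integral>\<^sup>+x. ennreal (u x) \<partial>\<mu>)"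
  using assms
proof (induct n arbitrary: u)
  case 0
  then show ?case by (simp add: paths_0 path_prob_def)
next
  case (Suc n)
  have "(\<integral>\<^sup>+x. ennreal (\<Sum>\<omega>\<in>paths r (Suc n) x. path_prob r (Suc n) \<omega> * u (\<omega> (Suc n))) \<partial>\<mu>) =
    (\<integral>\<^sup>+x. ennreal (R1 r u x) \<partial>\<mu>)"
    unfolding path_sum_Suc
    by (intro Suc.hyps) (use Suc.prems in \<open>auto intro: measurable_R1_nonneg R1_nonneg\<close>)
  then show ?case using Suc.prems by (simp add: nn_integral_R1)
qed

end

text \<open>A later coordinate determines all earlier ones, so an event on finitely many coordinates
  is an event on the last of them.\<close>

lemma solenoid_funpow: "\<omega> \<in> solenoid r \<Longrightarrow> (r ^^ k) (\<omega> (n + k)) = \<omega> n"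
  by (induct k) (auto simp: solenoid_def funpow_swap1)



section \<open>The shift\<close>

lemma r_inf_0 [simp]: "r_inf r \<omega> 0 = r (\<omega> 0)"
  by (simp add: r_inf_def)

lemma r_inf_Suc [simp]: "r_inf r \<omega> (Suc n) = \<omega> n"
  by (simp add: r_inf_def)

lemma r_inf_in_solenoid: 
  assumes "\<omega> \<in> solenoid r"
  shows "r_inf r \<omega> \<in> solenoid r"
  unfolding solenoid_def
proof (intro CollectI allI)
  fix n show "r (r_inf r \<omega> (Suc n)) = r_inf r \<omega> n"
    using assms by (cases n) (auto simp: solenoid_def)
qed

locale solenoid_space = strongly_invariant_map \<mu> r
  for \<mu> :: "'a::metric_space measure" and r +
  fixes \<nu> :: "(nat \<Rightarrow> 'a) measure"
  assumes nu: "solenoid_measure r \<mu> \<nu>"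
begin

section \<open>One-coordinate cylinders and the marginals of the solenoid measure\<close>

definition cyl :: "nat \<Rightarrow> 'a set \<Rightarrow> (nat \<Rightarrow> 'a) set" where
  "cyl n A = {\<omega> \<in> solenoid r. \<omega> n \<in> A}"

definition cylinders :: "(nat \<Rightarrow> 'a) set set" where
  "cylinders = {cyl n A | n A. A \<in> sets borel}"

lemma sets_nu: "sets \<nu> = sets (restrict_space (PiM UNIV (\<lambda>_. borel)) (solenoid r))"
  using nu by (simp add: solenoid_measure_def)

lemma space_nu [simp]: "space \<nu> = solenoid r"
  using sets_eq_imp_space_eq[OF sets_nu] by (simp add: space_restrict_space space_PiM)

lemma measurable_coord [measurable]: "(\<lambda>\<omega>. \<omega> n) \<in> measurable \<nu> \<mu>"
  unfolding measurable_cong_sets[OF sets_nu sets_mu]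
  by (intro measurable_restrict_space1 measurable_component_singleton) simp

lemma cyl_eq_vimage: "cyl n A = (\<lambda>\<omega>. \<omega> n) -` A \<inter> space \<nu>"
  by (auto simp: cyl_def)

lemma sets_cyl: "A \<in> sets borel \<Longrightarrow> cyl n A \<in> sets \<nu>"
  unfolding cyl_eq_vimage by (rule measurable_sets[OF measurable_coord]) simp

lemma cyl_UNIV: "cyl n UNIV = solenoid r"
  by (auto simp: cyl_def)

lemma cyl_shift: "cyl n A = cyl (n + k) ((r ^^ k) -` A)"
  using solenoid_funpow[of _ r k n] by (auto simp: cyl_def)

lemma measurable_funpow_r [measurable]: "r ^^ k \<in> measurable \<mu> \<mu>"
proof (induct k)
  case (Suc k)
  then show ?case using measurable_comp[OF Suc measurable_r] by simp
qed (simp add: id_def)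

text \<open>Two cylinders at coordinates \<open>n\<close> and \<open>m\<close> can both be rewritten
  at the common later coordinate \<open>n + m\<close>, where intersecting them means intersecting
  their bases.\<close>

lemma Int_stable_cylinders: "Int_stable cylinders"
proof -
  have *: "\<exists>C \<in> sets borel. cyl n A = cyl (n + k) C" if "A \<in> sets borel" for n k A
    using measurable_sets[OF measurable_funpow_r, of A k] that cyl_shift[of n A k] by auto
  show ?thesis
  proof (rule Int_stableI, unfold cylinders_def, clarify)
    fix n A m B assume AB: "A \<in> sets (borel :: 'a measure)" "B \<in> sets (borel :: 'a measure)"
    obtain A' B' where "A' \<in> sets borel" "B' \<in> sets borel"
      "cyl n A = cyl (n + m) A'" "cyl m B = cyl (n + m) B'"
      using *[OF AB(1), of n m] *[OF AB(2), of m n] by (auto simp: add.commute)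
    then show "\<exists>k C. cyl n A \<inter> cyl m B = cyl k C \<and> C \<in> sets borel"
      by (intro exI[of _ "n + m"] exI[of _ "A' \<inter> B'"]) (auto simp: cyl_def)
  qed
qed

lemma cylinders_Pow: "cylinders \<subseteq> Pow (solenoid r)"
  by (auto simp: cylinders_def cyl_def)

lemma sets_nu_cylinders: "sets \<nu> = sigma_sets (solenoid r) cylinders"
proof -
  \<comment> \<open>Writing traces on the solenoid as preimages under the identity allows the
    generator to be restricted before the sigma-algebra is formed.\<close>
  have *: "(\<inter>) S ` X = {(\<lambda>\<omega>. \<omega>) -` A \<inter> S | A. A \<in> X}" for S and X :: "(nat \<Rightarrow> 'a) set set"
    by (auto simp: image_def Int_commute)
  have "sets \<nu> = {(\<lambda>\<omega>. \<omega>) -` A \<inter> solenoid r | A. A \<in> sigma_sets UNIV {{f. f i \<in> A} | i A. A \<in> sets (borel :: 'a measure)}}"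
    unfolding sets_nu sets_restrict_space sets_PiM_single * by simp
  also have "\<dots> = sigma_sets (solenoid r)
      {(\<lambda>\<omega>. \<omega>) -` A \<inter> solenoid r | A. A \<in> {{f. f i \<in> A} | i A. A \<in> sets (borel :: 'a measure)}}"
    by (rule sigma_sets_vimage_commute) simp
  also have "{(\<lambda>\<omega>. \<omega>) -` A \<inter> solenoid r | A. A \<in> {{f. f i \<in> A} | i A. A \<in> sets (borel :: 'a measure)}} = cylinders"
  proof -
    have "(\<lambda>\<omega>. \<omega>) -` {f. f i \<in> A} \<inter> solenoid r = cyl i A" for i A
      by (auto simp: cyl_def)
    note * = this[symmetric]
    show ?thesis unfolding cylinders_def * by blast
  qed
  finally show ?thesis .
qed

text \<open>Every coordinate has law \<open>\<mu>\<close>. The defining formula is applied to a base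
  \<open>B\<close> that looks only at coordinate \<open>n\<close>, and the resulting path sum
  integrates to the same value as the indicator of \<open>A\<close>.\<close>

lemma emeasure_cyl:
  assumes "A \<in> sets borel"
  shows "emeasure \<nu> (cyl n A) = emeasure \<mu> A"
proof -
  define B where "B = {\<eta> \<in> space (PiM {..n} (\<lambda>_. borel :: 'a measure)). \<eta> n \<in> A}"
  have "B \<in> sets (PiM {..n} (\<lambda>_. borel))"
    unfolding B_def using assms by measurable
  moreover have B: "restrict \<omega> {..n} \<in> B \<longleftrightarrow> \<omega> n \<in> A" for \<omega>
    by (auto simp: B_def space_PiM)
  ultimately have "emeasure \<nu> {\<omega> \<in> solenoid r. restrict \<omega> {..n} \<in> B} =
      (\<integral>\<^sup>+x. ennreal (\<Sum>\<omega>\<in>paths r n x. path_prob r n \<omega> * indicator B (restrict \<omega> {..n})) \<partial>\<mu>)"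
    using nu unfolding solenoid_measure_def by blast
  then have "emeasure \<nu> (cyl n A) =
      (\<integral>\<^sup>+x. ennreal (\<Sum>\<omega>\<in>paths r n x. path_prob r n \<omega> * indicat_real A (\<omega> n)) \<partial>\<mu>)"
    by (simp add: cyl_def indicator_def B)
  also have "\<dots> = emeasure \<mu> A"
    using assms by (subst nn_integral_path_sum) (auto simp: ennreal_indicator)
  finally show ?thesis .
qed

sublocale nu: prob_space \<nu>
  by (rule prob_spaceI) (use emeasure_cyl[of UNIV 0] emeasure_space_1 in \<open>simp add: cyl_UNIV\<close>)

lemma distr_coord: "distr \<nu> \<mu> (\<lambda>\<omega>. \<omega> n) = \<mu>"
  by (rule measure_eqI) (simp_all add: emeasure_distr emeasure_cyl flip: cyl_eq_vimage space_nu)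

text \<open>Uniqueness of measures on an intersection-stable generator. The solenoid is itself a
  cylinder, so finite total mass makes it an exhausting sequence.\<close>

lemma measure_eq_if_eq_on_cylinders:
  assumes sets: "sets M = sets \<nu>" "sets N = sets \<nu>"
    and fin: "emeasure M (solenoid r) \<noteq> \<infinity>"
    and eq: "\<And>n A. A \<in> sets borel \<Longrightarrow> emeasure M (cyl n A) = emeasure N (cyl n A)"
  shows "M = N"
proof (rule measure_eqI_generator_eq[OF Int_stable_cylinders cylinders_Pow, where A="\<lambda>_. solenoid r"])
  show "range (\<lambda>_. solenoid r) \<subseteq> cylinders"
    by (auto simp: cylinders_def cyl_UNIV intro!: exI[of _ 0] exI[of _ UNIV])
qed (use assms in \<open>auto simp: sets_nu_cylinders cylinders_def\<close>)

section \<open>Shift invariance of the solenoid measure\<close>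

lemma measurable_r_inf [measurable]: "r_inf r \<in> measurable \<nu> \<nu>"
proof -
  have "r_inf r \<in> measurable \<nu> (restrict_space (PiM UNIV (\<lambda>_. borel)) (solenoid r))"
  proof (rule measurable_restrict_space2)
    show "r_inf r \<in> space \<nu> \<rightarrow> solenoid r"
      by (auto intro: r_inf_in_solenoid)
    show "r_inf r \<in> measurable \<nu> (PiM UNIV (\<lambda>_. borel))"
    proof (rule measurable_PiM_single')
      fix n
      show "(\<lambda>\<omega>. r_inf r \<omega> n) \<in> measurable \<nu> borel"
        using measurable_coord measurable_compose[OF measurable_coord measurable_r]
        by (cases n) (simp_all add: measurable_cong_sets[OF refl sets_mu])
    qed simp
  qed
  then show ?thesis by (simp add: measurable_cong_sets[OF refl sets_nu])
qed

lemma vimage_r_inf_cyl_Suc: "r_inf r -` cyl (Suc n) A \<inter> space \<nu> = cyl n A"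
  by (auto simp: cyl_def r_inf_in_solenoid)

lemma vimage_r_inf_cyl_0: "r_inf r -` cyl 0 A \<inter> space \<nu> = cyl 0 (r -` A)"
  by (auto simp: cyl_def r_inf_in_solenoid)

lemma distr_r_inf: "distr \<nu> \<nu> (r_inf r) = \<nu>"
proof (rule measure_eq_if_eq_on_cylinders)
  fix n and A :: "'a set" assume A: "A \<in> sets borel"
  then have rA: "r -` A \<in> sets borel" using measurable_sets[OF r_borel] by simp
  \<comment> \<open>Moving the cylinder to coordinate \<open>n + 1\<close> first makes its preimage
    under the shift a mere renumbering, also for \<open>n = 0\<close>.\<close>
  have "emeasure \<nu> (r_inf r -` cyl n A \<inter> space \<nu>) = emeasure \<nu> (cyl n (r -` A))"
    unfolding cyl_shift[of n A 1] using rA vimage_r_inf_cyl_Suc[of n "r -` A"] by simp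
  \<comment> \<open>The same cylinder read at coordinates \<open>n\<close> and \<open>n + 1\<close>
    shows that \<open>A\<close> and its preimage under \<open>r\<close> have equal measure.\<close>
  also have "\<dots> = emeasure \<mu> A"
    using emeasure_cyl[OF rA] emeasure_cyl[OF A, of n] cyl_shift[of n A 1] by simp
  finally show "emeasure (distr \<nu> \<nu> (r_inf r)) (cyl n A) = emeasure \<nu> (cyl n A)"
    using A by (simp add: emeasure_distr[OF measurable_r_inf sets_cyl] emeasure_cyl)
next
  interpret D: prob_space "distr \<nu> \<nu> (r_inf r)"
    by (rule nu.prob_space_distr) (rule measurable_r_inf)
  show "emeasure (distr \<nu> \<nu> (r_inf r)) (solenoid r) \<noteq> \<infinity>"
    by (simp add: D.emeasure_finite)
qed simp_all

lemma AE_comp_coord: "(AE x in \<mu>. P x) \<Longrightarrow> AE \<omega> in \<nu>. P (\<omega> n)"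
  by (rule AE_distrD[OF measurable_coord]) (subst distr_coord)

end

section \<open>Ergodicity\<close>

text \<open>A measurable injection of the plane into the unit disc, used to make functions bounded
  without losing invariance or the ability to recover their values.\<close>

definition squash :: "complex \<Rightarrow> complex" where
  "squash z = z / of_real (1 + cmod z)"

lemma norm_squash_le_1: "cmod (squash z) \<le> 1"
  unfolding squash_def norm_divide norm_of_real by (simp add: divide_le_eq not_less)

lemma squash_eq_iff: "squash z = squash w \<longleftrightarrow> z = w"
proof
  assume eq: "squash z = squash w"
  \<comment> \<open>The inverse map: the modulus \<open>t\<close> of the image equals
    \<open>s / (1 + s)\<close> for the modulus \<open>s\<close> of \<open>v\<close>, so
    \<open>1 - t = 1 / (1 + s)\<close>.\<close>
  have inv: "squash v / of_real (1 - cmod (squash v)) = v" for v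
  proof -
    have pos: "1 + cmod v > 0" by (simp add: add_pos_nonneg)
    then have "cmod (squash v) = cmod v / (1 + cmod v)"
      unfolding squash_def norm_divide norm_of_real by simp
    then have "1 - cmod (squash v) = 1 / (1 + cmod v)"
      using pos by (simp add: field_simps)
    then show ?thesis using pos by (simp add: squash_def del: of_real_add)
  qed
  show "z = w" using inv[of z] inv[of w] eq by simp
qed simp

lemma measurable_squash [measurable]: "squash \<in> borel_measurable borel"
  unfolding squash_def by measurable

lemma (in prob_space) AE_const_if_squash_const:
  assumes "AE x in M. squash (f x) = c"
  shows "\<exists>c. AE x in M. f x = c"
proof -
  \<comment> \<open>In a probability space an almost sure property holds somewhere; the value of
    \<open>f\<close> there is the constant.\<close>
  obtain x0 where "squash (f x0) = c"
    using eventually_happens'[OF ae_filter_bot assms] by auto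
  then have "AE x in M. f x = f x0"
    using assms by (auto simp: squash_eq_iff)
  then show ?thesis ..
qed

text \<open>\<open>ergodic_map\<close> tests essentially bounded functions; passing through the
  injective \<open>squash\<close> extends its conclusion to all measurable invariant
  functions.\<close>

lemma (in prob_space) ergodic_mapD:
  fixes f :: "'a \<Rightarrow> complex"
  assumes erg: "ergodic_map M T" and f: "f \<in> borel_measurable M"
    and inv: "AE x in M. f (T x) = f x"
  shows "\<exists>c. AE x in M. f x = c"
proof -
  have "(\<lambda>x. squash (f x)) \<in> borel_measurable M" using f by measurable
  moreover have "AE x in M. squash (f (T x)) = squash (f x)"
    using inv by eventually_elim simp
  ultimately have "\<exists>c. AE x in M. squash (f x) = c"
    using erg norm_squash_le_1 unfolding ergodic_map_def by blast
  then show ?thesis using AE_const_if_squash_const by blast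
qed

lemma (in finite_measure) bounded_in_L2:
  fixes h :: "'a \<Rightarrow> complex"
  assumes "h \<in> borel_measurable M" "AE x in M. cmod (h x) \<le> B"
  shows "h \<in> L2 M"
proof -
  have "integrable M (\<lambda>x. (cmod (h x))\<^sup>2)"
  proof (rule integrable_const_bound[of _ "B\<^sup>2"])
    show "AE x in M. norm ((cmod (h x))\<^sup>2) \<le> B\<^sup>2"
      using assms(2) by eventually_elim (simp add: power_mono)
  qed (use assms(1) in measurable)
  then show ?thesis using assms(1) by (simp add: L2_def)
qed

section \<open>Ergodicity and harmonic functions on the base\<close>

context strongly_invariant_map
begin

lemma ergodic_imp_L2_harmonic_const:
  assumes "ergodic_map \<mu> r" "h \<in> L2 \<mu>" "AE x in \<mu>. R1 r h x = h x"
  shows "\<exists>c. AE x in \<mu>. h x = c"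
  using assms ergodic_mapD comp_fixed_if_R1_fixed by (auto simp: L2_def)

lemma ergodic_if_bounded_harmonic_const:
  assumes "\<And>h::'a \<Rightarrow> complex. h \<in> borel_measurable \<mu> \<Longrightarrow> \<exists>B. \<forall>x. cmod (h x) \<le> B \<Longrightarrow>
    AE x in \<mu>. R1 r h x = h x \<Longrightarrow> \<exists>c. AE x in \<mu>. h x = c"
  shows "ergodic_map \<mu> r"
  unfolding ergodic_map_def
proof (intro allI impI)
  fix f :: "'a \<Rightarrow> complex"
  assume f [measurable]: "f \<in> borel_measurable \<mu>" and inv: "AE x in \<mu>. f (r x) = f x"
  \<comment> \<open>The harmonic condition concerns functions bounded at every point, while
    \<open>f\<close> is only essentially bounded; \<open>squash\<close> supplies the uniform
    bound.\<close>
  have "\<exists>c. AE x in \<mu>. squash (f x) = c"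
  proof (rule assms)
    show "\<exists>B. \<forall>x. cmod (squash (f x)) \<le> B" using norm_squash_le_1 by blast
    show "AE x in \<mu>. R1 r (\<lambda>x. squash (f x)) x = squash (f x)"
      by (rule R1_fixed_if_comp_fixed) (use inv in eventually_elim, simp)
  qed measurable
  then show "\<exists>c. AE x in \<mu>. f x = c" using AE_const_if_squash_const by blast
qed

end

section \<open>Ergodicity transferred between base and solenoid\<close>

context solenoid_space
begin

lemma ergodic_if_ergodic_r_inf:
  assumes "ergodic_map \<nu> (r_inf r)"
  shows "ergodic_map \<mu> r"
  unfolding ergodic_map_def
proof (intro allI impI)
  fix f :: "'a \<Rightarrow> complex"
  assume f [measurable]: "f \<in> borel_measurable \<mu>" and inv: "AE x in \<mu>. f (r x) = f x"
  have "(\<lambda>\<omega>. f (\<omega> 0)) \<in> borel_measurable \<nu>" by measurable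
  \<comment> \<open>Coordinate 0 of the shifted sequence is \<open>r (\<omega> 0)\<close>, so an
    \<open>r\<close>-invariant function lifts to a shift-invariant one.\<close>
  moreover have "AE \<omega> in \<nu>. f (r_inf r \<omega> 0) = f (\<omega> 0)"
    using AE_comp_coord[OF inv, of 0] by simp
  ultimately obtain c where c: "AE \<omega> in \<nu>. f (\<omega> 0) = c"
    using nu.ergodic_mapD[OF assms, of "\<lambda>\<omega>. f (\<omega> 0)"] by auto
  have "AE x in distr \<nu> \<mu> (\<lambda>\<omega>. \<omega> 0). f x = c"
  proof (subst AE_distr_iff)
    show "{x \<in> space \<mu>. f x = c} \<in> sets \<mu>" by measurable
  qed (use c in auto)
  then have "AE x in \<mu>. f x = c" by (subst (asm) distr_coord)
  then show "\<exists>c. AE x in \<mu>. f x = c" ..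
qed

text \<open>The measure \<open>f \<nu>\<close> is invariant under the shift, so it is determined by its 0-th marginal.
  That marginal is \<open>r\<close>-invariant and has a density \<open>h \<le> 1\<close> with respect to \<open>\<mu>\<close>; invariance
  means \<open>R1 r h = h\<close>, whence \<open>h\<close> is constant.\<close>

lemma ergodic_imp_const_real:
  fixes f :: "(nat \<Rightarrow> 'a) \<Rightarrow> real"
  assumes erg: "ergodic_map \<mu> r"
    and f [measurable]: "f \<in> borel_measurable \<nu>"
    and f01: "\<And>\<omega>. 0 \<le> f \<omega>" "\<And>\<omega>. f \<omega> \<le> 1"
    and inv: "AE \<omega> in \<nu>. f (r_inf r \<omega>) = f \<omega>"
  shows "\<exists>c. AE \<omega> in \<nu>. f \<omega> = c"
proof -
  define D where "D = density \<nu> f"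
  define m where "m = distr D \<mu> (\<lambda>\<omega>. \<omega> 0)"
  have sets_D [measurable_cong, simp]: "sets D = sets \<nu>" by (simp add: D_def)
  have space_D [simp]: "space D = solenoid r" by (simp add: D_def)
  have D: "emeasure D A = (\<integral>\<^sup>+\<omega>. ennreal (f \<omega>) * indicator A \<omega> \<partial>\<nu>)" if "A \<in> sets \<nu>" for A
    using that by (simp add: D_def emeasure_density)
  have D_le: "emeasure D A \<le> emeasure \<nu> A" if "A \<in> sets \<nu>" for A
  proof -
    have "emeasure D A \<le> (\<integral>\<^sup>+\<omega>. indicator A \<omega> \<partial>\<nu>)"
      unfolding D[OF that] using f01 by (intro nn_integral_mono) (auto simp: indicator_def)
    then show ?thesis using that by simp
  qed
  have D_inv: "emeasure D (r_inf r -` A \<inter> space \<nu>) = emeasure D A" if A [measurable]: "A \<in> sets \<nu>" for A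
  proof -
    have "r_inf r -` A \<inter> space \<nu> \<in> sets \<nu>" by measurable
    then have "emeasure D (r_inf r -` A \<inter> space \<nu>) =
        (\<integral>\<^sup>+\<omega>. ennreal (f \<omega>) * indicator (r_inf r -` A \<inter> space \<nu>) \<omega> \<partial>\<nu>)"
      by (rule D)
    \<comment> \<open>By invariance \<open>f\<close> may be replaced by its composition with the
      shift; the whole integrand is then such a composition and a change of variables
      applies.\<close>
    also have "\<dots> = (\<integral>\<^sup>+\<omega>. ennreal (f (r_inf r \<omega>)) * indicator A (r_inf r \<omega>) \<partial>\<nu>)"
      using inv AE_space by (intro nn_integral_cong_AE, eventually_elim) (auto simp: indicator_def)
    also have "\<dots> = (\<integral>\<^sup>+\<omega>. ennreal (f \<omega>) * indicator A \<omega> \<partial>distr \<nu> \<nu> (r_inf r))"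
      by (rule nn_integral_distr[symmetric]) measurable
    also have "\<dots> = emeasure D A" by (simp add: distr_r_inf D[OF A])
    finally show ?thesis .
  qed
  have D_cyl: "emeasure D (cyl n A) = emeasure D (cyl 0 A)" if "A \<in> sets borel" for n A
  proof (induct n)
    case (Suc n)
    then show ?case using D_inv[OF sets_cyl[OF that], of "Suc n"] by (simp only: vimage_r_inf_cyl_Suc)
  qed simp
  have m: "emeasure m A = emeasure D (cyl 0 A)" if "A \<in> sets borel" for A
    unfolding m_def using that by (subst emeasure_distr) (auto simp: cyl_def vimage_def Collect_conj_eq Int_commute)
  have sets_m: "sets m = sets \<mu>" by (simp add: m_def)
  \<comment> \<open>The bound \<open>f \<le> 1\<close> survives projection; it gives finiteness and
    absolute continuity of \<open>m\<close> now and \<open>h \<le> 1\<close> below.\<close>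
  have m_le: "emeasure m A \<le> emeasure \<mu> A" if "A \<in> sets borel" for A
    using D_le[OF sets_cyl[OF that]] by (simp add: m[OF that] emeasure_cyl[OF that])
  have m_inv: "emeasure m (r -` A) = emeasure m A" if A: "A \<in> sets borel" for A
  proof -
    have "r -` A \<in> sets borel" using measurable_sets[OF r_borel A] by simp
    then show ?thesis
      using D_inv[OF sets_cyl[OF A], of 0] by (simp only: m A vimage_r_inf_cyl_0)
  qed
  have "finite_measure m"
  proof (rule finite_measureI)
    have "emeasure m UNIV \<le> emeasure \<mu> UNIV" by (rule m_le) simp
    then show "emeasure m (space m) \<noteq> \<infinity>"
      using emeasure_finite[of UNIV] by (auto simp: m_def top_unique)
  qed
  moreover have "absolutely_continuous \<mu> m"
    using m_le by (auto simp: absolutely_continuous_def null_sets_def sets_m) (metis le_zero_eq)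
  ultimately obtain h where h [measurable]: "h \<in> borel_measurable \<mu>"
    and h_RN: "AE x in \<mu>. RN_deriv \<mu> m x = ennreal (h x)" and h0: "\<And>x. 0 \<le> h x"
    using real_RN_deriv[OF _ _ sets_m] by blast
  have dens: "density \<mu> h = m"
  proof -
    have "density \<mu> (RN_deriv \<mu> m) = m"
      by (rule density_RN_deriv) (use \<open>absolutely_continuous \<mu> m\<close> sets_m in auto)
    moreover have "density \<mu> (RN_deriv \<mu> m) = density \<mu> h"
      by (rule density_cong) (use h_RN in auto)
    ultimately show ?thesis by simp
  qed
  have m_h: "emeasure m A = (\<integral>\<^sup>+x. ennreal (h x) * indicator A x \<partial>\<mu>)" if "A \<in> sets borel" for A
    unfolding dens[symmetric] using that by (intro emeasure_density) auto
  note [measurable] = measurable_R1_nonneg[OF h h0]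
  \<comment> \<open>Integrating \<open>R1 r h\<close> over \<open>A\<close> equals integrating
    \<open>h\<close> over the preimage of \<open>A\<close>, by strong invariance; that is the
    \<open>m\<close>-measure of the preimage, hence of \<open>A\<close>. Uniqueness of densities
    then makes \<open>h\<close> harmonic.\<close>
  have "density \<mu> (R1 r h) = m"
  proof (rule measure_eqI)
    fix A assume "A \<in> sets (density \<mu> (R1 r h))"
    then have A [measurable]: "A \<in> sets borel" by simp
    have rA [measurable]: "r -` A \<in> sets borel" using measurable_sets[OF r_borel A] by simp
    have "emeasure (density \<mu> (R1 r h)) A = (\<integral>\<^sup>+x. ennreal (R1 r h x) * indicator A x \<partial>\<mu>)"
      by (rule emeasure_density) auto
    also have "\<dots> = (\<integral>\<^sup>+x. ennreal (R1 r (\<lambda>y. h y * indicator (r -` A) y) x) \<partial>\<mu>)"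
    proof (rule nn_integral_cong)
      fix x
      have "R1 r (\<lambda>y. h y * indicator (r -` A) y) x = R1 r (\<lambda>y. h y * indicator A x) x"
        by (rule R1_cong) (auto simp: indicator_def)
      then show "ennreal (R1 r h x) * indicator A x = ennreal (R1 r (\<lambda>y. h y * indicator (r -` A) y) x)"
        by (simp add: R1_mult_right) (simp add: indicator_def)
    qed
    also have "\<dots> = (\<integral>\<^sup>+x. ennreal (h x * indicator (r -` A) x) \<partial>\<mu>)"
      by (rule nn_integral_R1) (use h0 in auto)
    also have "\<dots> = (\<integral>\<^sup>+x. ennreal (h x) * indicator (r -` A) x \<partial>\<mu>)"
      by (intro nn_integral_cong) (simp add: indicator_def)
    also have "\<dots> = emeasure m A" using m_h[OF rA] m_inv[OF A] by simp
    finally show "emeasure (density \<mu> (R1 r h)) A = emeasure m A" .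
  qed (simp add: sets_m)
  then have "AE x in \<mu>. ennreal (R1 r h x) = ennreal (h x)"
    by (intro density_unique) (simp_all add: dens)
  then have R1_h: "AE x in \<mu>. R1 r h x = h x"
    by eventually_elim (simp add: h0 R1_nonneg)
  have h1: "AE x in \<mu>. h x \<le> 1"
  proof -
    \<comment> \<open>On the set where \<open>h > 1\<close> the mass of \<open>m\<close> is at most
      that of \<open>\<mu>\<close>, so the excess integral \<open>?e\<close> of \<open>h - 1\<close>
      must vanish.\<close>
    define A where "A = {x \<in> space \<mu>. 1 < h x}"
    have A [measurable]: "A \<in> sets \<mu>" unfolding A_def by measurable
    let ?e = "\<integral>\<^sup>+x. ennreal (h x - 1) * indicator A x \<partial>\<mu>"
    have "emeasure \<mu> A + ?e = (\<integral>\<^sup>+x. indicator A x + ennreal (h x - 1) * indicator A x \<partial>\<mu>)"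
    proof (subst nn_integral_add)
      show "emeasure \<mu> A + ?e = (\<integral>\<^sup>+x. indicator A x \<partial>\<mu>) + ?e"
        by (simp only: nn_integral_indicator[OF A])
    qed measurable
    also have "\<dots> = (\<integral>\<^sup>+x. ennreal (h x) * indicator A x \<partial>\<mu>)"
    proof (rule nn_integral_cong)
      fix x
      show "indicator A x + ennreal (h x - 1) * indicator A x = ennreal (h x) * indicator A x"
        using ennreal_plus[of 1 "h x - 1"] by (cases "x \<in> A") (auto simp: A_def)
    qed
    also have "\<dots> \<le> emeasure \<mu> A + 0"
      using m_le[of A] A by (simp flip: m_h)
    finally have "?e = 0"
      by (subst (asm) ennreal_add_left_cancel_le) (auto simp: emeasure_finite)
    then have "AE x in \<mu>. ennreal (h x - 1) * indicator A x = 0"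
      by (subst (asm) nn_integral_0_iff_AE) auto
    then show ?thesis
      by eventually_elim (auto simp: A_def indicator_def ennreal_eq_0_iff split: if_splits)
  qed
  have "(\<lambda>x. complex_of_real (h x)) \<in> L2 \<mu>"
    by (rule bounded_in_L2[of _ 1]) (use h0 h1 in auto)
  moreover have "AE x in \<mu>. R1 r (\<lambda>x. complex_of_real (h x)) x = complex_of_real (h x)"
    using R1_h by eventually_elim (simp add: R1_complex_of_real)
  ultimately obtain c where c: "AE x in \<mu>. complex_of_real (h x) = c"
    using ergodic_imp_L2_harmonic_const[OF erg] by blast
  have hc: "AE x in \<mu>. h x = Re c"
    using c by eventually_elim auto
  have "density \<nu> f = density \<nu> (\<lambda>_. ennreal (Re c))"
  proof (rule measure_eq_if_eq_on_cylinders)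
    show "emeasure (density \<nu> f) (solenoid r) \<noteq> \<infinity>"
      using D_le[of "solenoid r"] nu.emeasure_space_1 sets.top[of \<nu>] by (auto simp: D_def top_unique)
    fix n and A :: "'a set" assume A: "A \<in> sets borel"
    have "emeasure (density \<nu> f) (cyl n A) = emeasure m A"
      using D_cyl[OF A] m[OF A] by (simp add: D_def)
    also have "\<dots> = (\<integral>\<^sup>+x. ennreal (Re c) * indicator A x \<partial>\<mu>)"
      unfolding m_h[OF A] using hc by (intro nn_integral_cong_AE) auto
    also have "\<dots> = ennreal (Re c) * emeasure \<nu> (cyl n A)"
      using A by (simp add: nn_integral_cmult emeasure_cyl)
    also have "\<dots> = emeasure (density \<nu> (\<lambda>_. ennreal (Re c))) (cyl n A)"
      using sets_cyl[OF A] by (simp add: emeasure_density nn_integral_cmult)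
    finally show "emeasure (density \<nu> f) (cyl n A) = emeasure (density \<nu> (\<lambda>_. ennreal (Re c))) (cyl n A)" .
  qed simp_all
  then have "AE \<omega> in \<nu>. ennreal (f \<omega>) = ennreal (Re c)"
    by (intro nu.density_unique) auto
  \<comment> \<open>Since \<open>ennreal\<close> sends negative reals to 0, the sign of the constant
    is needed to return to real values.\<close>
  moreover have "0 \<le> Re c"
    using eventually_happens'[OF ae_filter_bot hc] h0 by metis
  ultimately have "AE \<omega> in \<nu>. f \<omega> = Re c"
    using f01 by auto
  then show ?thesis ..
qed

lemma ergodic_r_inf_if_ergodic:
  assumes "ergodic_map \<mu> r"
  shows "ergodic_map \<nu> (r_inf r)"
  unfolding ergodic_map_def
proof (intro allI impI)
  fix f :: "(nat \<Rightarrow> 'a) \<Rightarrow> complex"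
  assume f [measurable]: "f \<in> borel_measurable \<nu>" and inv: "AE \<omega> in \<nu>. f (r_inf r \<omega>) = f \<omega>"
  have *: "\<exists>c. AE \<omega> in \<nu>. p (squash (f \<omega>)) = c"
    if p [measurable]: "p \<in> borel_measurable borel" and p_le: "\<And>z. \<bar>p z\<bar> \<le> cmod z" for p :: "complex \<Rightarrow> real"
  proof -
    have "\<bar>p (squash (f \<omega>))\<bar> \<le> 1" for \<omega>
      using p_le norm_squash_le_1 order_trans by blast
    note p1 = this[unfolded abs_le_iff]
    \<comment> \<open>The values of \<open>p\<close> on the unit disc lie between -1 and 1; this
      affine map brings them into the unit interval, as the real case requires.\<close>
    have "\<exists>c. AE \<omega> in \<nu>. (1 + p (squash (f \<omega>))) / 2 = c"
    proof (rule ergodic_imp_const_real[OF assms])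
      show "0 \<le> (1 + p (squash (f \<omega>))) / 2" "(1 + p (squash (f \<omega>))) / 2 \<le> 1" for \<omega>
        using p1[of \<omega>] by auto
      show "AE \<omega> in \<nu>. (1 + p (squash (f (r_inf r \<omega>)))) / 2 = (1 + p (squash (f \<omega>))) / 2"
        using inv by eventually_elim simp
    qed measurable
    then obtain c where "AE \<omega> in \<nu>. (1 + p (squash (f \<omega>))) / 2 = c" ..
    then have "AE \<omega> in \<nu>. p (squash (f \<omega>)) = 2 * c - 1" by eventually_elim auto
    then show ?thesis ..
  qed
  obtain a b where "AE \<omega> in \<nu>. Re (squash (f \<omega>)) = a" "AE \<omega> in \<nu>. Im (squash (f \<omega>)) = b"
    using *[of Re] *[of Im] by (auto simp: abs_Re_le_cmod abs_Im_le_cmod)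
  then have "AE \<omega> in \<nu>. squash (f \<omega>) = Complex a b"
    by eventually_elim (simp add: complex_eq_iff)
  then show "\<exists>c. AE \<omega> in \<nu>. f \<omega> = c" by (rule nu.AE_const_if_squash_const)
qed

end

section \<open>The commutant of the wavelet representation\<close>

lemma cmod_add_power2_le: "(cmod (a + b))\<^sup>2 \<le> 2 * (cmod a)\<^sup>2 + 2 * (cmod b)\<^sup>2"
proof -
  have "(cmod (a + b))\<^sup>2 \<le> (cmod a + cmod b)\<^sup>2"
    by (intro power_mono norm_triangle_ineq) simp
  also have "\<dots> \<le> 2 * (cmod a)\<^sup>2 + 2 * (cmod b)\<^sup>2"
    using sum_squares_bound[of "cmod a" "cmod b"] by (simp add: power2_sum)
  finally show ?thesis .
qed

lemma L2_measurable: "f \<in> L2 M \<Longrightarrow> f \<in> borel_measurable M"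
  and L2_integrable: "f \<in> L2 M \<Longrightarrow> integrable M (\<lambda>x. (cmod (f x))\<^sup>2)"
  by (simp_all add: L2_def)

lemma L2_lincomb:
  assumes f: "f \<in> L2 M" and g: "g \<in> L2 M"
  shows "(\<lambda>x. a * f x + b * g x) \<in> L2 M"
proof -
  note [measurable] = L2_measurable[OF f] L2_measurable[OF g]
  have "integrable M (\<lambda>x. (cmod (a * f x + b * g x))\<^sup>2)"
  proof (rule Bochner_Integration.integrable_bound)
    show "integrable M (\<lambda>x. 2 * ((cmod a)\<^sup>2 * (cmod (f x))\<^sup>2) + 2 * ((cmod b)\<^sup>2 * (cmod (g x))\<^sup>2))"
      using L2_integrable[OF f] L2_integrable[OF g] by simp
    show "AE x in M. norm ((cmod (a * f x + b * g x))\<^sup>2) \<le>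
        norm (2 * ((cmod a)\<^sup>2 * (cmod (f x))\<^sup>2) + 2 * ((cmod b)\<^sup>2 * (cmod (g x))\<^sup>2))"
      using cmod_add_power2_le[of "a * f x" "b * g x" for x]
      by (auto simp: norm_mult power_mult_distrib)
  qed measurable
  then show ?thesis by (simp add: L2_def)
qed

lemma L2_bounded_mult:
  assumes f: "f \<in> L2 M" and g [measurable]: "g \<in> borel_measurable M"
    and B: "AE x in M. cmod (g x) \<le> B"
  shows "(\<lambda>x. g x * f x) \<in> L2 M"
    and "L2norm M (\<lambda>x. g x * f x) \<le> \<bar>B\<bar> * L2norm M f"
proof -
  note [measurable] = L2_measurable[OF f]
  have le: "AE x in M. (cmod (g x * f x))\<^sup>2 \<le> \<bar>B\<bar>\<^sup>2 * (cmod (f x))\<^sup>2"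
    using B
  proof eventually_elim
    case (elim x)
    then have "cmod (g x * f x) \<le> \<bar>B\<bar> * cmod (f x)"
      by (simp add: norm_mult mult_right_mono)
    then show ?case
      using power_mono[of "cmod (g x * f x)" "\<bar>B\<bar> * cmod (f x)" 2]
      by (simp only: power_mult_distrib norm_ge_zero)
  qed
  have int: "integrable M (\<lambda>x. \<bar>B\<bar>\<^sup>2 * (cmod (f x))\<^sup>2)"
    using L2_integrable[OF f] by simp
  have int': "integrable M (\<lambda>x. (cmod (g x * f x))\<^sup>2)"
    by (rule Bochner_Integration.integrable_bound[OF int]) (use le in auto)
  then show "(\<lambda>x. g x * f x) \<in> L2 M" by (simp add: L2_def)
  have "(\<integral>x. (cmod (g x * f x))\<^sup>2 \<partial>M) \<le> \<bar>B\<bar>\<^sup>2 * (\<integral>x. (cmod (f x))\<^sup>2 \<partial>M)"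
    using integral_mono_AE[OF int' int le] by simp
  then have "L2norm M (\<lambda>x. g x * f x) \<le> sqrt (\<bar>B\<bar>\<^sup>2 * (\<integral>x. (cmod (f x))\<^sup>2 \<partial>M))"
    by (simp add: L2norm_def)
  then show "L2norm M (\<lambda>x. g x * f x) \<le> \<bar>B\<bar> * L2norm M f"
    by (simp add: L2norm_def real_sqrt_mult)
qed

lemma L2norm_power2: "(L2norm M f)\<^sup>2 = (\<integral>x. (cmod (f x))\<^sup>2 \<partial>M)"
  by (simp add: L2norm_def)

section \<open>Eigenspaces of a bounded operator\<close>

definition eigenspace ::
  "'b measure \<Rightarrow> (('b \<Rightarrow> complex) \<Rightarrow> 'b \<Rightarrow> complex) \<Rightarrow> complex \<Rightarrow> ('b \<Rightarrow> complex) set" where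
  "eigenspace M T c = {f \<in> L2 M. AE x in M. T f x = c * f x}"

context
  fixes M :: "'b measure" and T :: "('b \<Rightarrow> complex) \<Rightarrow> 'b \<Rightarrow> complex" and c :: complex
  assumes T: "bounded_op M T"
begin

lemma bounded_op_L2: "f \<in> L2 M \<Longrightarrow> T f \<in> L2 M"
  using T by (simp add: bounded_op_def)

lemma bounded_op_lincomb:
  assumes "f \<in> L2 M" "g \<in> L2 M"
  shows "AE x in M. T (\<lambda>y. a * f y + b * g y) x = a * T f x + b * T g x"
  using T assms by (simp add: bounded_op_def)

lemma bounded_op_cong:
  assumes "f \<in> L2 M" "g \<in> L2 M" "AE x in M. f x = g x"
  shows "AE x in M. T f x = T g x"
  using T assms by (simp add: bounded_op_def)

lemma eigenspace_lincomb:
  assumes "f \<in> eigenspace M T c" "g \<in> eigenspace M T c"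
  shows "(\<lambda>x. a * f x + b * g x) \<in> eigenspace M T c"
proof -
  have "AE x in M. T (\<lambda>y. a * f y + b * g y) x = a * T f x + b * T g x"
    by (rule bounded_op_lincomb) (use assms in \<open>auto simp: eigenspace_def\<close>)
  moreover have "AE x in M. T f x = c * f x" "AE x in M. T g x = c * g x"
    using assms by (auto simp: eigenspace_def)
  ultimately have "AE x in M. T (\<lambda>y. a * f y + b * g y) x = c * (a * f x + b * g x)"
    by eventually_elim (simp add: algebra_simps)
  then show ?thesis
    using assms L2_lincomb by (auto simp: eigenspace_def)
qed

lemma eigenspace_cong:
  assumes f: "f \<in> eigenspace M T c" and g: "g \<in> L2 M" and eq: "AE x in M. f x = g x"
  shows "g \<in> eigenspace M T c"
proof -
  have "AE x in M. T f x = T g x"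
    using f g eq by (intro bounded_op_cong) (auto simp: eigenspace_def)
  moreover have "AE x in M. T f x = c * f x"
    using f by (simp add: eigenspace_def)
  ultimately have "AE x in M. T g x = c * g x"
    using eq by eventually_elim simp
  then show ?thesis using g by (simp add: eigenspace_def)
qed

text \<open>The defect \<open>T f - c * f\<close> depends continuously on \<open>f\<close> in norm
  and vanishes for every \<open>F n\<close>.\<close>

lemma eigenspace_closed:
  assumes F: "\<And>n. F n \<in> eigenspace M T c" and f: "f \<in> L2 M"
    and lim: "(\<lambda>n. \<integral>x. (cmod (f x - F n x))\<^sup>2 \<partial>M) \<longlonglongrightarrow> 0"
  shows "f \<in> eigenspace M T c"
proof -
  obtain C where C: "\<And>g. g \<in> L2 M \<Longrightarrow> L2norm M (T g) \<le> C * L2norm M g"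
    using T unfolding bounded_op_def by blast
  define d where "d x = T f x - c * f x" for x
  have d_L2: "d \<in> L2 M"
    using L2_lincomb[OF bounded_op_L2[OF f] f, of 1 "- c"] by (simp add: d_def[abs_def])
  \<comment> \<open>With \<open>g = f - F n\<close> the defect is \<open>T g - c * g\<close>; the
    constant comes from bounding the square of a sum by twice the sum of squares and the norm of
    \<open>T g\<close> by \<open>C\<close> times that of \<open>g\<close>.\<close>
  define K where "K = 2 * C\<^sup>2 + 2 * (cmod c)\<^sup>2"
  have le: "(\<integral>x. (cmod (d x))\<^sup>2 \<partial>M) \<le> K * (\<integral>x. (cmod (f x - F n x))\<^sup>2 \<partial>M)" for n
  proof -
    have Fn: "F n \<in> L2 M" "AE x in M. T (F n) x = c * F n x"
      using F[of n] by (auto simp: eigenspace_def)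
    define g where "g x = f x - F n x" for x
    have g_eq: "g = (\<lambda>x. 1 * f x + (-1) * F n x)" by (simp add: g_def[abs_def])
    have g: "g \<in> L2 M" unfolding g_eq by (rule L2_lincomb[OF f Fn(1)])
    note int = L2_integrable[OF g] L2_integrable[OF bounded_op_L2[OF g]]
    have "AE x in M. T g x = T f x - T (F n) x"
      using bounded_op_lincomb[OF f Fn(1), of 1 "-1"] unfolding g_eq by simp
    then have "AE x in M. (cmod (d x))\<^sup>2 \<le> 2 * (cmod (T g x))\<^sup>2 + 2 * (cmod c)\<^sup>2 * (cmod (g x))\<^sup>2"
      using Fn(2)
    proof eventually_elim
      case (elim x)
      then have "d x = T g x + - c * g x" by (simp add: d_def g_def algebra_simps)
      then show ?case
        using cmod_add_power2_le[of "T g x" "- c * g x"] by (simp add: norm_mult power_mult_distrib)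
    qed
    then have "(\<integral>x. (cmod (d x))\<^sup>2 \<partial>M) \<le> (\<integral>x. 2 * (cmod (T g x))\<^sup>2 + 2 * (cmod c)\<^sup>2 * (cmod (g x))\<^sup>2 \<partial>M)"
      using int L2_integrable[OF d_L2] by (intro integral_mono_AE) auto
    also have "\<dots> = 2 * (L2norm M (T g))\<^sup>2 + 2 * (cmod c)\<^sup>2 * (L2norm M g)\<^sup>2"
      using int by (simp add: L2norm_power2)
    also have "\<dots> \<le> 2 * (C * L2norm M g)\<^sup>2 + 2 * (cmod c)\<^sup>2 * (L2norm M g)\<^sup>2"
      using power_mono[OF C[OF g], of 2] by (simp add: L2norm_def)
    also have "\<dots> = K * (L2norm M g)\<^sup>2"
      by (simp add: K_def algebra_simps)
    finally show ?thesis by (simp add: L2norm_power2 g_def)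
  qed
  have "(\<lambda>n. K * (\<integral>x. (cmod (f x - F n x))\<^sup>2 \<partial>M)) \<longlonglongrightarrow> K * 0"
    by (intro tendsto_intros lim)
  then have "(\<integral>x. (cmod (d x))\<^sup>2 \<partial>M) \<le> 0"
    using le by (intro LIMSEQ_le_const) auto
  then have "(\<integral>x. (cmod (d x))\<^sup>2 \<partial>M) = 0"
    by (intro antisym) auto
  then have "AE x in M. (cmod (d x))\<^sup>2 = 0"
    using integral_nonneg_eq_0_iff_AE[OF L2_integrable[OF d_L2]] by simp
  then show ?thesis using f by (simp add: eigenspace_def d_def)
qed

lemma eigenspace_dominated:
  assumes F: "\<And>n. F n \<in> eigenspace M T c" and f: "f \<in> borel_measurable M"
    and lim: "\<And>x. x \<in> space M \<Longrightarrow> (\<lambda>n. F n x) \<longlonglongrightarrow> f x"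
    and w: "integrable M w" "\<And>n x. x \<in> space M \<Longrightarrow> (cmod (f x - F n x))\<^sup>2 \<le> w x"
      "\<And>x. x \<in> space M \<Longrightarrow> (cmod (f x))\<^sup>2 \<le> w x"
  shows "f \<in> eigenspace M T c"
proof (rule eigenspace_closed[OF F])
  have [measurable]: "F n \<in> borel_measurable M" for n
    using F[of n] by (auto simp: eigenspace_def L2_def)
  note [measurable] = f
  have "integrable M (\<lambda>x. (cmod (f x))\<^sup>2)"
    by (rule Bochner_Integration.integrable_bound[OF w(1)]) (use w(3) in \<open>auto intro: order_trans[OF _ abs_ge_self]\<close>)
  then show "f \<in> L2 M" using f by (simp add: L2_def)
  have "(\<lambda>n. (cmod (f x - F n x))\<^sup>2) \<longlonglongrightarrow> 0" if "x \<in> space M" for x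
  proof -
    have "(\<lambda>n. (cmod (f x - F n x))\<^sup>2) \<longlonglongrightarrow> (cmod (f x - f x))\<^sup>2"
      by (intro tendsto_intros lim that)
    then show ?thesis by simp
  qed
  then have "(\<lambda>n. \<integral>x. (cmod (f x - F n x))\<^sup>2 \<partial>M) \<longlonglongrightarrow> (\<integral>x. 0 \<partial>M)"
    by (intro integral_dominated_convergence[OF _ _ w(1)]) (use w(2) in auto)
  then show "(\<lambda>n. \<integral>x. (cmod (f x - F n x))\<^sup>2 \<partial>M) \<longlonglongrightarrow> 0" by simp
qed

text \<open>A scalar action tested on a generator extends to everything: to all measurable sets by a
  Dynkin argument, to nonnegative functions by monotone approximation, and to complex ones by
  decomposition.\<close>

lemma eigenspace_eq_L2:
  assumes fin: "finite_measure M"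
    and G: "Int_stable G" "G \<subseteq> Pow (space M)" "sets M = sigma_sets (space M) G"
    and basic: "\<And>A. A \<in> G \<Longrightarrow> (\<lambda>x. indicator A x) \<in> eigenspace M T c"
    and one: "(\<lambda>_. 1) \<in> eigenspace M T c"
  shows "f \<in> L2 M \<Longrightarrow> f \<in> eigenspace M T c"
proof -
  interpret finite_measure M by (rule fin)
  have zero: "(\<lambda>_. 0) \<in> eigenspace M T c"
    using eigenspace_lincomb[OF one one, of 0 0] by simp
  have indicator: "(\<lambda>x. indicator A x) \<in> eigenspace M T c" if "A \<in> sets M" for A
    using G(1,2) that[unfolded G(3)]
  proof (induct rule: sigma_sets_induct_disjoint)
    case (compl A)
    have "(\<lambda>x. 1 * 1 + (-1) * indicator A x) \<in> eigenspace M T c"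
      by (rule eigenspace_lincomb[OF one compl(2)])
    moreover have "(\<lambda>x. indicator (space M - A) x) \<in> L2 M"
    proof (rule bounded_in_L2[of _ 1])
      have "A \<in> sets M" using compl(1) by (simp add: G(3))
      then show "(\<lambda>x. indicator (space M - A) x :: complex) \<in> borel_measurable M" by measurable
    qed (simp add: indicator_def)
    moreover have "AE x in M. 1 * 1 + (-1) * indicator A x = (indicator (space M - A) x :: complex)"
      using AE_space by eventually_elim (auto simp: indicator_def)
    ultimately show ?case by (rule eigenspace_cong)
  next
    case (union A)
    have A: "A i \<in> sets M" for i using union(2) by (auto simp: G(3))
    have ind: "(\<lambda>x. indicator (\<Union>i<n. A i) x) \<in> eigenspace M T c" for n
    proof (induct n)
      case (Suc n)
      have "disjoint_family_on A {..<Suc n}"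
        using union(1) by (auto simp: disjoint_family_on_def)
      then have "(indicator (\<Union>i<Suc n. A i) x :: complex) = 1 * indicator (\<Union>i<n. A i) x + 1 * indicator (A n) x" for x
        by (subst (1 2) indicator_UN_disjoint) (auto simp: disjoint_family_on_def)
      then show ?case using eigenspace_lincomb[OF Suc union(3)[of n], of 1 1] by presburger
    qed (simp add: zero)
    show ?case
    proof (rule eigenspace_dominated[OF ind, where w="\<lambda>_. 1"])
      show "(\<lambda>n. indicator (\<Union>i<n. A i) x :: complex) \<longlonglongrightarrow> indicator (\<Union>i. A i) x" for x
        by (rule LIMSEQ_indicator_UN)
    qed (use A in \<open>auto simp: indicator_def\<close>)
  qed (simp_all add: basic zero)
  \<comment> \<open>Square-integrability stands inside the induction claim, because each building
    block has to inherit it from the function it helps to build.\<close>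
  have nonneg: "integrable M (\<lambda>x. (u x)\<^sup>2) \<longrightarrow> (\<lambda>x. complex_of_real (u x)) \<in> eigenspace M T c"
    if "u \<in> borel_measurable M" "\<And>x. 0 \<le> u x" for u
    using that
  proof (induct rule: borel_measurable_induct_real)
    case (set A)
    then show ?case using indicator by (simp add: of_real_indicator)
  next
    case (mult u a)
    show ?case
    \<comment> \<open>For \<open>a = 0\<close> square-integrability of the product says nothing
      about \<open>u\<close>.\<close>
    proof (cases "a = 0")
      case False
      then show ?thesis
        using mult eigenspace_lincomb[of "\<lambda>x. of_real (u x)" "\<lambda>_. 0" a 0] zero
        by (auto simp: power_mult_distrib)
    qed (simp add: zero)
  next
    case (add u v)
    note [measurable] = add(1,4)
    show ?case
    proof
      assume int: "integrable M (\<lambda>x. (v x + u x)\<^sup>2)"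
      \<comment> \<open>Both summands are nonnegative, so each is dominated by the sum.\<close>
      have "integrable M (\<lambda>x. (u x)\<^sup>2)" "integrable M (\<lambda>x. (v x)\<^sup>2)"
        by (rule Bochner_Integration.integrable_bound[OF int];
            use add in \<open>auto intro!: AE_I2 power_mono\<close>)+
      then show "(\<lambda>x. complex_of_real (v x + u x)) \<in> eigenspace M T c"
        using add eigenspace_lincomb[of "\<lambda>x. of_real (v x)" "\<lambda>x. of_real (u x)" 1 1] by simp
    qed
  next
    case (seq U)
    have U_le: "U i x \<le> u x" if "x \<in> space M" for i x
      using seq(4) seq(5)[OF that] by (intro incseq_le) (auto simp: incseq_def le_fun_def)
    show ?case
    proof
      assume int: "integrable M (\<lambda>x. (u x)\<^sup>2)"
      have "integrable M (\<lambda>x. (U i x)\<^sup>2)" for i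
        by (rule Bochner_Integration.integrable_bound[OF int])
          (use seq U_le in \<open>auto intro!: AE_I2 power_mono\<close>)
      then have ev: "(\<lambda>x. complex_of_real (U i x)) \<in> eigenspace M T c" for i
        using seq(3) by blast
      show "(\<lambda>x. complex_of_real (u x)) \<in> eigenspace M T c"
      proof (rule eigenspace_dominated[where F="\<lambda>i x. complex_of_real (U i x)", OF ev _ _ int])
        fix i x assume x: "x \<in> space M"
        have "\<bar>u x - U i x\<bar> \<le> \<bar>u x\<bar>" using U_le[OF x, of i] seq(2)[of i x] by auto
        then show "(cmod (complex_of_real (u x) - complex_of_real (U i x)))\<^sup>2 \<le> (u x)\<^sup>2"
          by (simp add: abs_le_square_iff flip: of_real_diff)
      next
        show "(\<lambda>x. complex_of_real (u x)) \<in> borel_measurable M"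
          using borel_measurable_LIMSEQ_real[OF seq(5) seq(1)] by measurable
      qed (use seq in \<open>auto intro: tendsto_of_real\<close>)
    qed
  qed
  assume f: "f \<in> L2 M"
  note [measurable] = L2_measurable[OF f]
  have part: "(\<lambda>x. complex_of_real (max 0 (p x))) \<in> eigenspace M T c"
    if [measurable]: "p \<in> borel_measurable M" and p: "\<And>x. \<bar>p x\<bar> \<le> cmod (f x)" for p
  proof -
    have "integrable M (\<lambda>x. (max 0 (p x))\<^sup>2)"
    proof (rule Bochner_Integration.integrable_bound[OF L2_integrable[OF f]])
      show "AE x in M. norm ((max 0 (p x))\<^sup>2) \<le> norm ((cmod (f x))\<^sup>2)"
        using p by (auto intro!: AE_I2 power_mono simp: abs_le_iff)
    qed measurable
    then show ?thesis using nonneg[of "\<lambda>x. max 0 (p x)"] by simp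
  qed
  have diff: "(\<lambda>x. complex_of_real (p x)) \<in> eigenspace M T c"
    if [measurable]: "p \<in> borel_measurable M" and p: "\<And>x. \<bar>p x\<bar> \<le> cmod (f x)" for p
  proof -
    \<comment> \<open>Decomposition into positive and negative parts; \<open>p\<close> stands for
      the real or the imaginary part of \<open>f\<close>.\<close>
    have "(\<lambda>x. 1 * complex_of_real (max 0 (p x)) + (-1) * complex_of_real (max 0 (- p x))) \<in> eigenspace M T c"
      by (intro eigenspace_lincomb part) (use p in auto)
    moreover have "1 * complex_of_real (max 0 t) + (-1) * complex_of_real (max 0 (- t)) = complex_of_real t" for t
      by (simp add: max_def)
    ultimately show ?thesis by simp
  qed
  have "(\<lambda>x. 1 * complex_of_real (Re (f x)) + \<i> * complex_of_real (Im (f x))) \<in> eigenspace M T c"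
    by (intro eigenspace_lincomb diff) (auto simp: abs_Re_le_cmod abs_Im_le_cmod)
  then show "f \<in> eigenspace M T c" by (simp flip: complex_eq)
qed

end

section \<open>The commutant on the solenoid\<close>

context solenoid_space
begin

lemma L2_r_inf:
  assumes f: "f \<in> L2 \<nu>"
  shows "wav_U r f \<in> L2 \<nu>"
proof -
  note [measurable] = L2_measurable[OF f]
  have "integrable (distr \<nu> \<nu> (r_inf r)) (\<lambda>\<omega>. (cmod (f \<omega>))\<^sup>2)"
    using L2_integrable[OF f] by (simp add: distr_r_inf)
  then have "integrable \<nu> (\<lambda>\<omega>. (cmod (f (r_inf r \<omega>)))\<^sup>2)"
    by (subst (asm) integrable_distr_eq) measurable
  then show ?thesis by (simp add: L2_def wav_U_def)
qed

text \<open>The shift preserves the measure, so the exceptional set and its preimage are null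
  together. This cancels a shift without inverting it.\<close>

lemma AE_eq_if_AE_eq_r_inf:
  fixes u v :: "(nat \<Rightarrow> 'a) \<Rightarrow> complex"
  assumes [measurable]: "u \<in> borel_measurable \<nu>" "v \<in> borel_measurable \<nu>"
    and eq: "AE \<omega> in \<nu>. u (r_inf r \<omega>) = v (r_inf r \<omega>)"
  shows "AE \<omega> in \<nu>. u \<omega> = v \<omega>"
proof -
  have "AE \<omega> in distr \<nu> \<nu> (r_inf r). u \<omega> = v \<omega>"
  proof (subst AE_distr_iff)
    show "{\<omega> \<in> space \<nu>. u \<omega> = v \<omega>} \<in> sets \<nu>" by measurable
  qed (use eq in auto)
  then show ?thesis by (subst (asm) distr_r_inf)
qed

text \<open>Multiplication by a bounded invariant \<open>F\<close> commutes with other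
  multiplications, and with \<open>wav_U r\<close> because \<open>F\<close> is invariant. If it is
  scalar, its value on the function 1 shows that \<open>F\<close> is constant.\<close>

lemma wavelet_irreducible_imp_ergodic:
  assumes irr: "wavelet_irreducible r \<mu> \<nu>"
  shows "ergodic_map \<nu> (r_inf r)"
  unfolding ergodic_map_def
proof (intro allI impI)
  fix F :: "(nat \<Rightarrow> 'a) \<Rightarrow> complex"
  assume F: "F \<in> borel_measurable \<nu>" and "\<exists>B. AE \<omega> in \<nu>. cmod (F \<omega>) \<le> B"
    and inv: "AE \<omega> in \<nu>. F (r_inf r \<omega>) = F \<omega>"
  then obtain B where B: "AE \<omega> in \<nu>. cmod (F \<omega>) \<le> B" by blast
  define T where "T f = (\<lambda>\<omega>. F \<omega> * f \<omega>)" for f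
  have "bounded_op \<nu> T"
    unfolding bounded_op_def
  proof (intro conjI ballI allI impI)
    show "\<exists>C. \<forall>f\<in>L2 \<nu>. L2norm \<nu> (T f) \<le> C * L2norm \<nu> f"
      unfolding T_def using L2_bounded_mult(2)[OF _ F B] by blast
    show "T f \<in> L2 \<nu>" if "f \<in> L2 \<nu>" for f
      unfolding T_def using L2_bounded_mult(1)[OF that F B] .
  qed (auto simp: T_def algebra_simps)
  moreover have "AE \<omega> in \<nu>. T (wav_U r f) \<omega> = wav_U r (T f) \<omega>" for f
    using inv by eventually_elim (simp add: T_def wav_U_def)
  moreover have "AE \<omega> in \<nu>. T (wav_pi g f) \<omega> = wav_pi g (T f) \<omega>" for g f
    by (simp add: T_def wav_pi_def)
  ultimately obtain c where c: "\<forall>f\<in>L2 \<nu>. AE \<omega> in \<nu>. T f \<omega> = c * f \<omega>"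
    using irr unfolding wavelet_irreducible_def by blast
  moreover have "(\<lambda>_. 1) \<in> L2 \<nu>" by (simp add: L2_def)
  ultimately have "AE \<omega> in \<nu>. T (\<lambda>_. 1) \<omega> = c * 1" by blast
  then show "\<exists>c. AE \<omega> in \<nu>. F \<omega> = c" by (auto simp: T_def)
qed

text \<open>Composing with the shift turns multiplication by \<open>g (\<omega> (n + 1))\<close> into multiplication by
  \<open>g (\<omega> n)\<close>.\<close>

lemma commutant_coord:
  assumes T: "bounded_op \<nu> T"
    and U: "\<And>f. f \<in> L2 \<nu> \<Longrightarrow> AE \<omega> in \<nu>. T (wav_U r f) \<omega> = wav_U r (T f) \<omega>"
    and g: "g \<in> borel_measurable \<mu>" "AE x in \<mu>. cmod (g x) \<le> B"
    and pi: "\<And>f. f \<in> L2 \<nu> \<Longrightarrow> AE \<omega> in \<nu>. T (wav_pi g f) \<omega> = wav_pi g (T f) \<omega>"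
    and f: "f \<in> L2 \<nu>"
  shows "AE \<omega> in \<nu>. T (\<lambda>\<omega>. g (\<omega> n) * f \<omega>) \<omega> = g (\<omega> n) * T f \<omega>"
  using f
proof (induct n arbitrary: f)
  case 0
  then show ?case using pi by (simp add: wav_pi_def[abs_def] theta0_def)
next
  case (Suc n)
  note [measurable] = g(1)
  have mult_L2: "(\<lambda>\<omega>. g (\<omega> k) * h \<omega>) \<in> L2 \<nu>" if "h \<in> L2 \<nu>" for h k
    by (rule L2_bounded_mult(1)[OF that _ AE_comp_coord[OF g(2)]]) measurable
  let ?f = "\<lambda>\<omega>. g (\<omega> (Suc n)) * f \<omega>"
  have U_f: "wav_U r ?f = (\<lambda>\<omega>. g (\<omega> n) * wav_U r f \<omega>)"
    by (simp add: wav_U_def)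
  have "AE \<omega> in \<nu>. T (wav_U r ?f) \<omega> = g (\<omega> n) * T (wav_U r f) \<omega>"
    unfolding U_f by (rule Suc.hyps[OF L2_r_inf[OF Suc.prems]])
  moreover have "AE \<omega> in \<nu>. T (wav_U r ?f) \<omega> = wav_U r (T ?f) \<omega>"
    by (rule U[OF mult_L2[OF Suc.prems]])
  moreover have "AE \<omega> in \<nu>. T (wav_U r f) \<omega> = wav_U r (T f) \<omega>"
    by (rule U[OF Suc.prems])
  \<comment> \<open>Both sides are now compositions with the shift, which can be cancelled.\<close>
  ultimately have "AE \<omega> in \<nu>. T ?f (r_inf r \<omega>) = g (r_inf r \<omega> (Suc n)) * T f (r_inf r \<omega>)"
    by eventually_elim (simp add: wav_U_def)
  moreover have [measurable]: "T ?f \<in> borel_measurable \<nu>" "T f \<in> borel_measurable \<nu>"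
    using T mult_L2 Suc.prems by (auto simp: bounded_op_def L2_def)
  ultimately show ?case
    by (intro AE_eq_if_AE_eq_r_inf[of "T ?f" "\<lambda>\<omega>. g (\<omega> (Suc n)) * T f \<omega>"]) measurable
qed

lemma ergodic_imp_wavelet_irreducible:
  assumes erg: "ergodic_map \<nu> (r_inf r)"
  shows "wavelet_irreducible r \<mu> \<nu>"
  unfolding wavelet_irreducible_def
proof (intro allI impI)
  fix T :: "((nat \<Rightarrow> 'a) \<Rightarrow> complex) \<Rightarrow> (nat \<Rightarrow> 'a) \<Rightarrow> complex"
  assume T: "bounded_op \<nu> T"
    and U: "\<forall>f\<in>L2 \<nu>. AE \<omega> in \<nu>. T (wav_U r f) \<omega> = wav_U r (T f) \<omega>"
    and pi: "\<forall>g::'a \<Rightarrow> complex. g \<in> borel_measurable \<mu> \<longrightarrow> (\<exists>B. AE x in \<mu>. cmod (g x) \<le> B) \<longrightarrow>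
      (\<forall>f\<in>L2 \<nu>. AE \<omega> in \<nu>. T (wav_pi g f) \<omega> = wav_pi g (T f) \<omega>)"
  have one: "(\<lambda>_. 1) \<in> L2 \<nu>" by (simp add: L2_def)
  have "T (\<lambda>_. 1) \<in> borel_measurable \<nu>"
    using T one by (auto simp: bounded_op_def L2_def)
  moreover have "AE \<omega> in \<nu>. T (\<lambda>_. 1) (r_inf r \<omega>) = T (\<lambda>_. 1) \<omega>"
    using bspec[OF U one] by (simp add: wav_U_def eq_commute)
  \<comment> \<open>The image of 1 is known only to be square-integrable, so ergodicity is used in
    its form for unbounded functions.\<close>
  ultimately obtain c where c: "AE \<omega> in \<nu>. T (\<lambda>_. 1) \<omega> = c"
    using nu.ergodic_mapD[OF erg] by blast
  have "f \<in> eigenspace \<nu> T c" if "f \<in> L2 \<nu>" for f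
  proof (rule eigenspace_eq_L2[OF T _ Int_stable_cylinders _ _ _ _ that])
    show "finite_measure \<nu>" by unfold_locales
    show "cylinders \<subseteq> Pow (space \<nu>)" "sets \<nu> = sigma_sets (space \<nu>) cylinders"
      by (simp_all add: cylinders_Pow sets_nu_cylinders)
    show "(\<lambda>_. 1) \<in> eigenspace \<nu> T c"
      using one c by (simp add: eigenspace_def)
    fix S :: "(nat \<Rightarrow> 'a) set" assume "S \<in> cylinders"
    then obtain n A where S: "S = cyl n A" and A [measurable]: "A \<in> sets borel"
      by (auto simp: cylinders_def)
    let ?g = "indicator A :: 'a \<Rightarrow> complex"
    \<comment> \<open>The factor 1 exhibits the indicator as a multiplication operator applied to 1.
      Off the solenoid \<open>?f\<close> may differ from the indicator of \<open>S\<close>, hence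
      the almost everywhere comparison.\<close>
    let ?f = "\<lambda>\<omega>. ?g (\<omega> n) * 1"
    have eq: "AE \<omega> in \<nu>. indicator S \<omega> = ?f \<omega>"
      using AE_space by eventually_elim (auto simp: S cyl_def indicator_def)
    have S_meas [measurable]: "S \<in> sets \<nu>" by (simp add: S sets_cyl A)
    have S_L2: "(\<lambda>\<omega>. indicator S \<omega>) \<in> L2 \<nu>"
      by (rule nu.bounded_in_L2[of _ 1]) (auto simp: indicator_def)
    have "?f \<in> borel_measurable \<nu>"
      using measurable_compose[OF measurable_coord, of ?g borel n] A by simp
    then have f_L2: "?f \<in> L2 \<nu>"
      by (rule nu.bounded_in_L2[of _ 1]) (auto simp: indicator_def)
    have "AE \<omega> in \<nu>. T (\<lambda>\<omega>. indicator S \<omega>) \<omega> = T ?f \<omega>"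
      by (rule bounded_op_cong[OF T S_L2 f_L2 eq])
    moreover have "AE \<omega> in \<nu>. T ?f \<omega> = ?g (\<omega> n) * T (\<lambda>_. 1) \<omega>"
    proof (rule commutant_coord[OF T])
      show "AE x in \<mu>. cmod (?g x) \<le> 1" by (auto simp: indicator_def)
      show "?g \<in> borel_measurable \<mu>" by measurable
      then show "AE \<omega> in \<nu>. T (wav_pi ?g f) \<omega> = wav_pi ?g (T f) \<omega>" if "f \<in> L2 \<nu>" for f
        using pi that \<open>AE x in \<mu>. cmod (?g x) \<le> 1\<close> by blast
    qed (use U one in auto)
    ultimately have "AE \<omega> in \<nu>. T (\<lambda>\<omega>. indicator S \<omega>) \<omega> = c * indicator S \<omega>"
      using c eq by eventually_elim simp
    then show "(\<lambda>\<omega>. indicator S \<omega>) \<in> eigenspace \<nu> T c"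
      using S_L2 by (simp add: eigenspace_def)
  qed
  then show "\<exists>c. \<forall>f\<in>L2 \<nu>. AE \<omega> in \<nu>. T f \<omega> = c * f \<omega>"
    by (auto simp: eigenspace_def)
qed

end

theorem theorem3p1:
  fixes r :: "'a::metric_space \<Rightarrow> 'a"
    and \<mu> :: "'a measure"
    and \<nu> :: "(nat \<Rightarrow> 'a) measure"
  assumes compact_X: "compact (UNIV :: 'a set)"
    and r_meas: "r \<in> borel_measurable borel"
    and fibres: "\<forall>x. r -` {x} \<noteq> {} \<and> finite (r -` {x})"
    and mu_borel: "sets \<mu> = sets borel"
    and mu_prob: "prob_space \<mu>"
    and mu_strong: "strongly_invariant r \<mu>"
    and nu_def: "solenoid_measure r \<mu> \<nu>"
  shows "(ergodic_map \<nu> (r_inf r) \<longleftrightarrow> wavelet_irreducible r \<mu> \<nu>)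
       \<and> (wavelet_irreducible r \<mu> \<nu> \<longleftrightarrow>
            (\<forall>h::'a \<Rightarrow> complex. h \<in> borel_measurable \<mu> \<longrightarrow> (\<exists>B. \<forall>x. cmod (h x) \<le> B) \<longrightarrow>
               (AE x in \<mu>. R1 r h x = h x) \<longrightarrow> (\<exists>c. AE x in \<mu>. h x = c)))
       \<and> ((\<forall>h::'a \<Rightarrow> complex. h \<in> borel_measurable \<mu> \<longrightarrow> (\<exists>B. \<forall>x. cmod (h x) \<le> B) \<longrightarrow>
               (AE x in \<mu>. R1 r h x = h x) \<longrightarrow> (\<exists>c. AE x in \<mu>. h x = c)) \<longleftrightarrow>
          (\<forall>h::'a \<Rightarrow> complex. h \<in> L2 \<mu> \<longrightarrow>
               (AE x in \<mu>. R1 r h x = h x) \<longrightarrow> (\<exists>c. AE x in \<mu>. h x = c)))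
       \<and> ((\<forall>h::'a \<Rightarrow> complex. h \<in> L2 \<mu> \<longrightarrow>
               (AE x in \<mu>. R1 r h x = h x) \<longrightarrow> (\<exists>c. AE x in \<mu>. h x = c)) \<longleftrightarrow>
          ergodic_map \<mu> r)"
proof -
  interpret prob_space \<mu> by (rule mu_prob)
  interpret solenoid_space \<mu> r \<nu>
    by unfold_locales (use assms in auto)
  let ?irr = "wavelet_irreducible r \<mu> \<nu>"
  let ?bdd = "\<forall>h::'a \<Rightarrow> complex. h \<in> borel_measurable \<mu> \<longrightarrow> (\<exists>B. \<forall>x. cmod (h x) \<le> B) \<longrightarrow>
    (AE x in \<mu>. R1 r h x = h x) \<longrightarrow> (\<exists>c. AE x in \<mu>. h x = c)"
  let ?L2 = "\<forall>h::'a \<Rightarrow> complex. h \<in> L2 \<mu> \<longrightarrow>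
    (AE x in \<mu>. R1 r h x = h x) \<longrightarrow> (\<exists>c. AE x in \<mu>. h x = c)"
  have "ergodic_map \<nu> (r_inf r) \<longleftrightarrow> ?irr"
    using wavelet_irreducible_imp_ergodic ergodic_imp_wavelet_irreducible by blast
  moreover have "ergodic_map \<nu> (r_inf r) \<longleftrightarrow> ergodic_map \<mu> r"
    using ergodic_if_ergodic_r_inf ergodic_r_inf_if_ergodic by blast
  \<comment> \<open>The remaining conditions are linked in a cycle: ergodicity of \<open>r\<close>,
    the \<open>L2\<close> condition, the bounded condition, and back.\<close>
  moreover have "ergodic_map \<mu> r \<Longrightarrow> ?L2"
    using ergodic_imp_L2_harmonic_const by blast
  moreover have "?L2 \<Longrightarrow> ?bdd"
    using bounded_in_L2[OF _ AE_I2] by blast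
  moreover have "?bdd \<Longrightarrow> ergodic_map \<mu> r"
    by (rule ergodic_if_bounded_harmonic_const) blast
  ultimately show ?thesis by argo
qed

end
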